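(* Let $n\geq 2$. Then the $n$th Houghton group $H_n$ is co-context-free (co$CF$); that is, its co-word problem is a context-free language.
   Context: Co-word problem: let $G$ be a group with a finite generating set $X$. The word problem $W(G,X)$ is the set of all words in $(X^{\pm})^*$ (words in the generators and their inverses) that represent the identity of $G$. The co-word problem $\mathrm{coW}(G,X)$ is its complement, the set of words in $(X^{\pm})^*$ that do not represent $1$ in $G$. A finitely generated group $G$ is called co$CF$ if $\mathrm{coW}(G,X)$ is a context-free language. This is known to be independent of the choice of finite generating set $X$. Houghton groups: a quasi-automorphism of a locally finite graph $\Gamma=(V,E)$ is a permutation of $V$ that respects all but finitely many adjacencies; the group of all quasi-automorphisms is $\mathrm{QAut}(\Gamma)$. Regard $\mathbb{N}_0$ as the graph whose vertices are the non-negative integers, with $\{i,j\}$ an edge if and only if $i=j\pm1$. Let $*^n_0$ be the disjoint union of $n$ copies of $\mathbb{N}_0$, with $(k,l)$ denoting the vertex $k$ of the $l$th copy ($k\in\mathbb{N}_0$, $l\in\{1,\ldots,n\}$). For each $\Phi\in\mathrm{QAut}( *^n_0)$ there exist $r>0$, $s_1,\ldots,s_n\in\mathbb{Z}$ and a permutation $\varphi\in S_n$ such that $\Phi(k,l)=(k+s_l,\varphi(l))$ for all $k>r$ and all $l$. The $n$th Houghton group $H_n$ is the subgroup of all $\Phi\in\mathrm{QAut}( *^n_0)$ for which $\varphi$ is the identity of $S_n$. For $n\geq 2$ the group $H_n$ is finitely generated. *)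

theory Defs
  imports "HOL-Algebra.Bij" "HOL-Algebra.Generated_Groups" "HOL-Combinatorics.Permutations"
begin

section \<open>Context-free languages\<close>

datatype ('n, 't) symb = NT 'n | Tm 't

type_synonym ('n, 't) prods = "('n \<times> ('n, 't) symb list) set"

inductive derive_step :: "('n, 't) prods \<Rightarrow> ('n, 't) symb list \<Rightarrow> ('n, 't) symb list \<Rightarrow> bool"
  for P where
  "(A, \<alpha>) \<in> P \<Longrightarrow> derive_step P (u @ [NT A] @ v) (u @ \<alpha> @ v)"

definition cfg_lang :: "('n, 't) prods \<Rightarrow> 'n \<Rightarrow> 't list set" where
  "cfg_lang P S = {w. (derive_step P)\<^sup>*\<^sup>* [NT S] (map Tm w)}"

text \<open>Only finitely many nonterminals occur in a finite set of productions, so taking natural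
  numbers as nonterminals is no restriction.\<close>

definition context_free :: "'t set \<Rightarrow> 't list set \<Rightarrow> bool" where
  "context_free \<Sigma> L \<longleftrightarrow>
     finite \<Sigma> \<and>
     (\<exists>(P :: (nat, 't) prods) S.
        finite P \<and> (\<forall>(A, \<alpha>) \<in> P. set \<alpha> \<subseteq> range NT \<union> Tm ` \<Sigma>) \<and> L = cfg_lang P S)"


section \<open>Word and co-word problem\<close>

text \<open>Inverse letters are formal symbols: \<open>Inv x\<close> is a letter different from \<open>Gen y\<close>,
  even if the inverse of \<open>x\<close> happens to be the generator \<open>y\<close>.\<close>

datatype 'a letter = Gen 'a | Inv 'a

definition letters :: "'a set \<Rightarrow> 'a letter set" where
  "letters X = Gen ` X \<union> Inv ` X"

fun letter_val :: "('a, 'b) monoid_scheme \<Rightarrow> 'a letter \<Rightarrow> 'a" where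
  "letter_val G (Gen x) = x"
| "letter_val G (Inv x) = inv\<^bsub>G\<^esub> x"

fun word_val :: "('a, 'b) monoid_scheme \<Rightarrow> 'a letter list \<Rightarrow> 'a" where
  "word_val G [] = \<one>\<^bsub>G\<^esub>"
| "word_val G (a # w) = letter_val G a \<otimes>\<^bsub>G\<^esub> word_val G w"

definition word_problem :: "('a, 'b) monoid_scheme \<Rightarrow> 'a set \<Rightarrow> 'a letter list set" where
  "word_problem G X = {w \<in> lists (letters X). word_val G w = \<one>\<^bsub>G\<^esub>}"

definition coword_problem :: "('a, 'b) monoid_scheme \<Rightarrow> 'a set \<Rightarrow> 'a letter list set" where
  "coword_problem G X = lists (letters X) - word_problem G X"

definition finite_generating_set :: "('a, 'b) monoid_scheme \<Rightarrow> 'a set \<Rightarrow> bool" where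
  "finite_generating_set G X \<longleftrightarrow>
     finite X \<and> X \<subseteq> carrier G \<and> generate G X = carrier G"

text \<open>Context-freeness of the co-word problem does not depend on the finite generating set; it is
  required here of all of them, and separately that there is one.\<close>

definition coCF :: "('a, 'b) monoid_scheme \<Rightarrow> bool" where
  "coCF G \<longleftrightarrow>
     group G \<and> (\<exists>X. finite_generating_set G X) \<and>
     (\<forall>X. finite_generating_set G X \<longrightarrow> context_free (letters X) (coword_problem G X))"


section \<open>Quasi-automorphisms and Houghton groups\<close>

text \<open>A graph is given by its vertex set \<open>V\<close> and its set \<open>E\<close> of two-element edges. Elements of
  \<^term>\<open>Bij V\<close> are bijections of \<open>V\<close> that are \<^term>\<open>undefined\<close> outside \<open>V\<close>, which makes them equal
  as soon as they agree on \<open>V\<close>.\<close>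

definition QAut :: "'a set \<Rightarrow> 'a set set \<Rightarrow> ('a \<Rightarrow> 'a) monoid" where
  "QAut V E = (BijGroup V)
     \<lparr>carrier := {\<Phi> \<in> Bij V.
        finite {(u, v) \<in> V \<times> V. ({u, v} \<in> E) \<noteq> ({\<Phi> u, \<Phi> v} \<in> E)}}\<rparr>"

definition ray_verts :: "nat \<Rightarrow> (nat \<times> nat) set" where
  "ray_verts n = UNIV \<times> {1..n}"

definition ray_edges :: "nat \<Rightarrow> (nat \<times> nat) set set" where
  "ray_edges n = {{(i, l), (j, l)} | i j l. l \<in> {1..n} \<and> (i = j + 1 \<or> j = i + 1)}"

text \<open>\<open>end_perm n \<Phi> \<phi>\<close>: far out, \<open>\<Phi>\<close> translates the \<open>l\<close>th ray into the \<open>\<phi> l\<close>th ray.\<close>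

definition end_perm :: "nat \<Rightarrow> (nat \<times> nat \<Rightarrow> nat \<times> nat) \<Rightarrow> (nat \<Rightarrow> nat) \<Rightarrow> bool" where
  "end_perm n \<Phi> \<phi> \<longleftrightarrow> \<phi> permutes {1..n} \<and>
     (\<exists>r > 0. \<exists>s :: nat \<Rightarrow> int. \<forall>k > r. \<forall>l \<in> {1..n}.
        int (fst (\<Phi> (k, l))) = int k + s l \<and> snd (\<Phi> (k, l)) = \<phi> l)"

definition houghton_group :: "nat \<Rightarrow> (nat \<times> nat \<Rightarrow> nat \<times> nat) monoid" where
  "houghton_group n = (QAut (ray_verts n) (ray_edges n))
     \<lparr>carrier := {\<Phi> \<in> carrier (QAut (ray_verts n) (ray_edges n)). end_perm n \<Phi> id}\<rparr>"

end

theory Submission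
  imports Defs "HOL-Library.Countable"
begin

text \<open>
  Why the co-word problem of \<open>H\<^sub>n\<close> is context-free. A word is read as a composition of
  permutations of the vertex set, its last letter acting first; it is nontrivial iff it moves some
  vertex. Far from the origins every letter acts on each ray as a translation, so a pushdown
  automaton can follow a vertex \<open>(k, l)\<close> by storing \<open>k\<close> in unary on its stack. What it cannot do is
  compare the end of the journey with a starting point that was unboundedly far out, because by
  then the stack content has been used up. Two observations remove this difficulty.

  First, if a word moves anything, then it moves a vertex whose trajectory comes near the origins
  (lemma \<open>moves_near_after_rotation\<close>). Indeed, suppose that all such vertices are fixed. The other
  vertices on a given ray are then permuted among themselves, by a translation because their
  trajectories never leave the region of translations. A set of natural numbers that is mapped onto
  itself by a translation has a least element that goes to itself, so the translation is trivial.

  Second, cutting the word at the moment of the visit and exchanging the two parts conjugates the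
  permutation and makes the journey start near the origins. So the co-word problem is
  the set of all rotations of the language of words that move one of the finitely many vertices
  near the origins. For this language there is a one-counter automaton, as the starting point can
  be kept in the finite control (theorem \<open>context_free_low_moves\<close>), and the set of
  rotations of a context-free language is context-free (lemma \<open>context_free_cyclic_closure\<close>).

  The group \<open>H\<^sub>n\<close> itself consists of all bijections of the rays that are eventually translations
  on each ray: such a bijection spoils only finitely many adjacencies. It is generated by
  one transposition together with the maps \<open>slide n l\<close>, each of which moves the line formed by the
  rays \<open>1\<close> and \<open>l\<close> by one step: the slides cancel the translation at infinity, what remains is a
  finitary permutation, and conjugating the one transposition by slides produces all others.
\<close>

section \<open>Languages generated by sentential forms\<close>

text \<open>The big-step form of derivation. Since the subderivations of the symbols of a sentential form are
separate premises, proofs by rule induction never have to disentangle interleaved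
rewriting steps.\<close>

inductive yields :: "('n, 't) prods \<Rightarrow> ('n, 't) symb list \<Rightarrow> 't list \<Rightarrow> bool"
  for P where
  Nil: "yields P [] []"
| Tm: "yields P \<gamma> w \<Longrightarrow> yields P (Tm c # \<gamma>) (c # w)"
| NT: "(A, \<alpha>) \<in> P \<Longrightarrow> yields P \<alpha> u \<Longrightarrow> yields P \<gamma> v \<Longrightarrow> yields P (NT A # \<gamma>) (u @ v)"

inductive_cases yields_NilE: "yields P [] w"
inductive_cases yields_TmE: "yields P (Tm c # \<gamma>) w"
inductive_cases yields_NTE: "yields P (NT A # \<gamma>) w"

lemma yields_appendI: "yields P \<alpha> u \<Longrightarrow> yields P \<beta> v \<Longrightarrow> yields P (\<alpha> @ \<beta>) (u @ v)"
  by (induction rule: yields.induct) (auto intro: yields.intros)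

lemma yields_append:
  "yields P (\<alpha> @ \<beta>) w \<longleftrightarrow> (\<exists>u v. w = u @ v \<and> yields P \<alpha> u \<and> yields P \<beta> v)"
proof
  show "yields P (\<alpha> @ \<beta>) w \<Longrightarrow> \<exists>u v. w = u @ v \<and> yields P \<alpha> u \<and> yields P \<beta> v"
  proof (induction \<alpha> arbitrary: w)
    case Nil
    then show ?case by (auto intro: yields.Nil)
  next
    case (Cons x \<alpha>)
    show ?case
    proof (cases x)
      case (NT A)
      with Cons.prems obtain \<delta> u v where "(A, \<delta>) \<in> P" "yields P \<delta> u" "yields P (\<alpha> @ \<beta>) v" "w = u @ v"
        by (auto elim: yields_NTE)
      with Cons.IH[of v] NT show ?thesis
        by (metis append.assoc yields.NT)
    next
      case (Tm c)
      with Cons.prems obtain v where "yields P (\<alpha> @ \<beta>) v" "w = c # v"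
        by (auto elim: yields_TmE)
      with Cons.IH[of v] Tm show ?thesis
        by (metis append_Cons yields.Tm)
    qed
  qed
qed (auto intro: yields_appendI)

lemma yields_NT_singleI: "(A, \<alpha>) \<in> P \<Longrightarrow> yields P \<alpha> w \<Longrightarrow> yields P [NT A] w"
  using yields.NT[OF _ _ yields.Nil] by force

lemma yields_NT_single: "yields P [NT A] w \<longleftrightarrow> (\<exists>\<alpha>. (A, \<alpha>) \<in> P \<and> yields P \<alpha> w)"
  by (auto elim!: yields_NTE yields_NilE intro: yields_NT_singleI)

lemma yields_NT_Cons:
  "yields P (NT A # \<gamma>) w \<longleftrightarrow>
    (\<exists>\<alpha> u v. w = u @ v \<and> (A, \<alpha>) \<in> P \<and> yields P \<alpha> u \<and> yields P \<gamma> v)"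
  by (auto elim!: yields_NTE intro: yields.NT)

lemma yields_Tm_Cons: "yields P (Tm c # \<gamma>) w \<longleftrightarrow> (\<exists>v. w = c # v \<and> yields P \<gamma> v)"
  by (auto intro: yields.Tm elim: yields_TmE)

lemma yields_Nil_iff: "yields P [] w \<longleftrightarrow> w = []"
  by (auto intro: yields.Nil elim: yields_NilE)

lemmas yields_simps = yields_Nil_iff yields_Tm_Cons yields_NT_Cons yields_append

text \<open>Rewriting may be done under any context, which lets the derivations of the parts of a sentential
form be run one after the other in \<open>derives_iff_yields\<close>.\<close>

lemma derives_context:
  "(derive_step P)\<^sup>*\<^sup>* \<alpha> \<beta> \<Longrightarrow> (derive_step P)\<^sup>*\<^sup>* (u @ \<alpha> @ v) (u @ \<beta> @ v)"
proof (induction rule: rtranclp_induct)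
  case (step y z)
  from step.hyps(2) have "derive_step P (u @ y @ v) (u @ z @ v)"
  proof cases
    case (1 A \<alpha> u' v')
    then show ?thesis
      using derive_step.intros[of A \<alpha> P "u @ u'" "v' @ v"] by simp
  qed
  with step.IH show ?case by (rule rtranclp.rtrancl_into_rtrancl)
qed simp

lemma derives_iff_yields: "(derive_step P)\<^sup>*\<^sup>* \<gamma> (map Tm w) \<longleftrightarrow> yields P \<gamma> w"
proof
  have terminal: "yields P (map Tm w) w"
    by (induction w) (auto intro: yields.intros)
  have expand: "yields P \<alpha> w" if "derive_step P \<alpha> \<beta>" "yields P \<beta> w" for \<alpha> \<beta>
    using that(1)
  proof cases
    case (1 A \<delta> u v)
    with that(2) show ?thesis
      by (auto simp: yields_append yields_NT_Cons) blast
  qed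
  show "(derive_step P)\<^sup>*\<^sup>* \<gamma> (map Tm w) \<Longrightarrow> yields P \<gamma> w"
    by (induction rule: converse_rtranclp_induct) (use terminal expand in auto)
  show "yields P \<gamma> w \<Longrightarrow> (derive_step P)\<^sup>*\<^sup>* \<gamma> (map Tm w)"
  proof (induction rule: yields.induct)
    case (Tm \<gamma> w c)
    then show ?case using derives_context[of P \<gamma> "map Tm w" "[Tm c]" "[]"] by simp
  next
    case (NT A \<alpha> u \<gamma> v)
    have "derive_step P (NT A # \<gamma>) (\<alpha> @ \<gamma>)"
      using derive_step.intros[OF NT.hyps(1), of "[]" \<gamma>] by simp
    moreover have "(derive_step P)\<^sup>*\<^sup>* (\<alpha> @ \<gamma>) (map Tm u @ \<gamma>)"
      using derives_context[OF NT.IH(1), of "[]" \<gamma>] by simp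
    moreover have "(derive_step P)\<^sup>*\<^sup>* (map Tm u @ \<gamma>) (map Tm u @ map Tm v)"
      using derives_context[OF NT.IH(2), of "map Tm u" "[]"] by simp
    ultimately show ?case
      by (metis converse_rtranclp_into_rtranclp rtranclp_trans map_append)
  qed simp
qed

lemma cfg_lang_yields: "cfg_lang P S = {w. yields P [NT S] w}"
  by (simp add: cfg_lang_def derives_iff_yields)

text \<open>The language of a sentential form when each nonterminal \<open>A\<close> is interpreted by the language
\<open>I A\<close>. A grammar is a system of language inequations, and the languages that it generates are the
least solution; \<open>yields_sem\<close> is the half of this that proves grammars sound.\<close>

fun sem :: "('n \<Rightarrow> 't list set) \<Rightarrow> ('n, 't) symb list \<Rightarrow> 't list set" where
  "sem I [] = {[]}"
| "sem I (Tm c # \<gamma>) = (#) c ` sem I \<gamma>"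
| "sem I (NT A # \<gamma>) = {u @ v | u v. u \<in> I A \<and> v \<in> sem I \<gamma>}"

lemma sem_append: "sem I (\<alpha> @ \<beta>) = {u @ v | u v. u \<in> sem I \<alpha> \<and> v \<in> sem I \<beta>}"
proof (induction I \<alpha> rule: sem.induct)
  case (2 I c \<gamma>)
  then show ?case by (auto simp: image_iff) (metis append_Cons)+
next
  case (3 I A \<gamma>)
  then show ?case by auto (metis append.assoc)+
qed simp

lemma yields_sem:
  assumes "\<And>A \<alpha>. (A, \<alpha>) \<in> P \<Longrightarrow> sem I \<alpha> \<subseteq> I A"
  shows "yields P \<gamma> w \<Longrightarrow> w \<in> sem I \<gamma>"
  by (induction rule: yields.induct) (use assms in \<open>auto, blast\<close>)

text \<open>The generated languages are themselves an interpretation. It is used below as the part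
of a bigger interpretation that concerns the nonterminals of an embedded grammar.\<close>

lemma sem_yields: "sem (\<lambda>A. {w. yields P [NT A] w}) \<gamma> = {w. yields P \<gamma> w}"
proof (induction \<gamma>)
  case (Cons X \<gamma>)
  then show ?case by (cases X) (fastforce simp: yields_simps)+
qed (simp add: yields_Nil_iff)

abbreviation rename :: "('n \<Rightarrow> 'm) \<Rightarrow> ('n, 't) symb list \<Rightarrow> ('m, 't) symb list" where
  "rename f \<equiv> map (map_symb f id)"

lemma sem_rename: "sem I (rename f \<gamma>) = sem (I \<circ> f) \<gamma>"
  by (induction "I \<circ> f" \<gamma> rule: sem.induct) auto

lemma yields_rename:
  assumes "(\<lambda>(A, \<alpha>). (f A, rename f \<alpha>)) ` P \<subseteq> Q"
  shows "yields P \<gamma> w \<Longrightarrow> yields Q (rename f \<gamma>) w"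
proof (induction rule: yields.induct)
  case (NT A \<alpha> u \<gamma> v)
  with assms have "(f A, rename f \<alpha>) \<in> Q" by force
  from yields.NT[OF this NT.IH] show ?case by simp
qed (auto intro: yields.intros)

lemma terminals_rename:
  assumes "set \<alpha> \<subseteq> range NT \<union> Tm ` \<Sigma>"
  shows "set (rename f \<alpha>) \<subseteq> range NT \<union> Tm ` \<Sigma>"
proof -
  have "map_symb f id x \<in> range NT \<union> Tm ` \<Sigma>" if "x \<in> range NT \<union> Tm ` \<Sigma>" for x
    using that by (cases x) auto
  with assms show ?thesis by auto
qed

text \<open>Numbering the nonterminals costs nothing, so grammars may be written with
nonterminals of any countable type. The interpretation \<open>?I\<close> in the proof transports the
generated languages along the injective numbering; at a number that encodes no nonterminal it is
the set of all words.\<close>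

lemma context_freeI:
  fixes P :: "('n :: countable, 't) prods"
  assumes "finite \<Sigma>" and "finite P"
    and terminals: "\<And>A \<alpha>. (A, \<alpha>) \<in> P \<Longrightarrow> set \<alpha> \<subseteq> range NT \<union> Tm ` \<Sigma>"
    and "L = {w. yields P [NT S] w}"
  shows "context_free \<Sigma> L"
proof -
  let ?f = "to_nat :: 'n \<Rightarrow> nat"
  let ?Q = "(\<lambda>(A, \<alpha>). (?f A, rename ?f \<alpha>)) ` P"
  let ?I = "\<lambda>m. {w. \<forall>A. m = ?f A \<longrightarrow> yields P [NT A] w}"
  have sem: "sem (?I \<circ> ?f) \<alpha> = {w. yields P \<alpha> w}" for \<alpha>
  proof -
    have "?I \<circ> ?f = (\<lambda>A. {w. yields P [NT A] w})" by (auto simp: fun_eq_iff)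
    then show ?thesis by (simp only: sem_yields)
  qed
  have "yields ?Q [NT (?f S)] w \<longleftrightarrow> yields P [NT S] w" for w
  proof
    assume "yields ?Q [NT (?f S)] w"
    moreover have "sem ?I \<beta> \<subseteq> ?I B" if "(B, \<beta>) \<in> ?Q" for B \<beta>
    proof -
      from that obtain A \<alpha> where A: "(A, \<alpha>) \<in> P" "B = ?f A" "\<beta> = rename ?f \<alpha>" by auto
      then have "sem ?I \<beta> = {w. yields P \<alpha> w}" by (simp only: sem_rename sem)
      with A show ?thesis by (auto simp: yields_NT_single)
    qed
    ultimately have "w \<in> sem ?I [NT (?f S)]" by (rule yields_sem[rotated])
    then show "yields P [NT S] w" by simp
  next
    assume "yields P [NT S] w"
    then show "yields ?Q [NT (?f S)] w" using yields_rename[of ?f P ?Q "[NT S]" w] by simp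
  qed
  then have "L = cfg_lang ?Q (?f S)" using assms(4) by (simp add: cfg_lang_yields)
  moreover have "set \<beta> \<subseteq> range NT \<union> Tm ` \<Sigma>" if "(B, \<beta>) \<in> ?Q" for B \<beta>
  proof -
    from that obtain A \<alpha> where "(A, \<alpha>) \<in> P" "\<beta> = rename ?f \<alpha>" by auto
    with terminals show ?thesis by (metis terminals_rename)
  qed
  moreover have "finite ?Q" using assms(2) by simp
  ultimately have "finite ?Q \<and> (\<forall>p \<in> ?Q. case p of (B, \<beta>) \<Rightarrow> set \<beta> \<subseteq> range NT \<union> Tm ` \<Sigma>) \<and>
      L = cfg_lang ?Q (?f S)"
    by (metis (lifting) case_prodI2)
  with assms(1) show ?thesis unfolding context_free_def
    by (intro conjI[OF _ exI[of _ ?Q, OF exI[of _ "?f S"]]])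
qed

section \<open>Cyclic closure\<close>

text \<open>The nonterminals of the grammar for the rotations of \<open>L\<close>. \<open>Around A\<close> generates the words \<open>v @ u\<close>
such that \<open>S\<close> derives \<open>u A v\<close>, that is, everything outside of a subtree at \<open>A\<close>, with the part to the
right first. \<open>Cut\<close> generates the rotations; it chooses the letter at which the word is cut.\<close>

datatype 'n cyc = Old 'n | Around 'n | Cut

instance cyc :: (countable) countable
  by countable_datatype

text \<open>The contexts of \<open>A\<close> in derivations from \<open>S\<close>. The path from the root to \<open>A\<close> is recorded one
production at a time because the turned grammar follows this path in the opposite direction.\<close>

inductive surrounds :: "('n, 't) prods \<Rightarrow> 'n \<Rightarrow> 'n \<Rightarrow> 't list \<Rightarrow> 't list \<Rightarrow> bool" for P S where
  start: "surrounds P S S [] []"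
| step: "surrounds P S B u v \<Longrightarrow> (B, \<alpha> @ NT A # \<beta>) \<in> P \<Longrightarrow> yields P \<alpha> x \<Longrightarrow> yields P \<beta> y
    \<Longrightarrow> surrounds P S A (u @ x) (y @ v)"

lemma surrounds_yields:
  "surrounds P S A u v \<Longrightarrow> yields P [NT A] w \<Longrightarrow> yields P [NT S] (u @ w @ v)"
proof (induction arbitrary: w rule: surrounds.induct)
  case (step B u v \<alpha> A \<beta> x y)
  have "yields P (\<alpha> @ NT A # \<beta>) (x @ w @ y)"
    using yields_appendI[OF step.hyps(3) yields_appendI[OF step.prems step.hyps(4)]] by simp
  with step.hyps(2) have "yields P [NT B] (x @ w @ y)"
    using yields_NT_single by metis
  from step.IH[OF this] show ?case by simp
qed simp

text \<open>Every letter of a derived word is introduced by a definite production \<open>B' \<rightarrow> \<alpha>' c \<beta>'\<close> at a definite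
node of the derivation tree. The induction descends from a node \<open>B\<close> of which \<open>\<gamma>\<close> is a block of
children; \<open>\<alpha>\<close> and \<open>\<beta>\<close> are the children to the left and to the right of the block, and
\<open>x0\<close> and \<open>y0\<close> are the words that they derive.\<close>

lemma locate_letter:
  assumes "yields P \<gamma> (x @ c # y)" and "surrounds P S B u v" and "(B, \<alpha> @ \<gamma> @ \<beta>) \<in> P"
    and "yields P \<alpha> x0" and "yields P \<beta> y0"
  shows "\<exists>B' \<alpha>' \<beta>' u' v' x' y'. surrounds P S B' u' v' \<and> (B', \<alpha>' @ Tm c # \<beta>') \<in> P \<and>
    yields P \<alpha>' x' \<and> yields P \<beta>' y' \<and> u @ x0 @ x = u' @ x' \<and> y @ y0 @ v = y' @ v'"
  using assms
proof (induction \<gamma> "x @ c # y" arbitrary: x y B u v \<alpha> \<beta> x0 y0 rule: yields.induct)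
  case Nil
  then show ?case by simp
next
  case (Tm \<gamma> w d)
  show ?case
  proof (cases x)
    case Nil
    with Tm.hyps(3) have "d = c" "w = y" by auto
    have "yields P (\<gamma> @ \<beta>) (y @ y0)"
      using yields_appendI[OF Tm.hyps(1) Tm.prems(4)] \<open>w = y\<close> by simp
    moreover have "(B, \<alpha> @ Tm c # \<gamma> @ \<beta>) \<in> P" using Tm.prems(2) \<open>d = c\<close> by simp
    ultimately show ?thesis using Tm.prems Nil
      by (intro exI[of _ B] exI[of _ \<alpha>] exI[of _ "\<gamma> @ \<beta>"] exI[of _ u] exI[of _ v]
          exI[of _ x0] exI[of _ "y @ y0"]) auto
  next
    case (Cons a x1)
    with Tm.hyps(3) have "w = x1 @ c # y" "a = d" by auto
    moreover have "yields P (\<alpha> @ [Tm d]) (x0 @ [d])"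
      using Tm.prems(3) by (auto simp: yields_simps)
    ultimately show ?thesis
      using Tm.hyps(2)[of x1 y B u v "\<alpha> @ [Tm d]" \<beta> "x0 @ [d]" y0] Tm.prems Cons by simp
  qed
next
  case (NT A \<delta> u1 \<gamma> v1)
  from \<open>u1 @ v1 = x @ c # y\<close> consider z where "u1 = x @ c # z" "y = z @ v1"
    | z where "x = u1 @ z" "v1 = z @ c # y"
    by (auto simp: append_eq_append_conv2 append_eq_Cons_conv Cons_eq_append_conv)
  then show ?case
  proof cases
    case 1
    have "yields P (\<gamma> @ \<beta>) (v1 @ y0)"
      using yields_appendI[OF NT.hyps(4) NT.prems(4)] .
    then have outer: "surrounds P S A (u @ x0) ((v1 @ y0) @ v)"
      using NT.prems by (intro surrounds.step[of P S B u v \<alpha> A "\<gamma> @ \<beta>"]) auto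
    have "(A, [] @ \<delta> @ []) \<in> P" using NT.hyps(1) by simp
    from NT.hyps(3)[OF 1(1) outer this yields.Nil yields.Nil]
    show ?thesis unfolding 1(2) append_assoc append_Nil .
  next
    case 2
    have "yields P (\<alpha> @ [NT A]) (x0 @ u1)"
      using yields_appendI[OF NT.prems(3) yields.NT[OF NT.hyps(1,2) yields.Nil]] by simp
    then show ?thesis
      using NT.hyps(5)[of z y B u v "\<alpha> @ [NT A]" \<beta> "x0 @ u1" y0] NT.prems 2 by simp
  qed
qed

text \<open>Going up the tree instead of down: if \<open>A\<close> occurs in \<open>B \<rightarrow> \<alpha> A \<beta>\<close>, then what is outside of \<open>A\<close> is,
read cyclically from its right end, \<open>\<beta>\<close>, then what is outside of \<open>B\<close>, then \<open>\<alpha>\<close>. This gives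
\<open>Around A \<rightarrow> \<beta> (Around B) \<alpha>\<close>. An occurrence of a letter \<open>c\<close> likewise gives the rotations that
begin with this \<open>c\<close>.\<close>

definition turn :: "'n \<times> ('n, 't) symb list \<Rightarrow> nat \<Rightarrow> 'n cyc \<times> ('n cyc, 't) symb list" where
  "turn = (\<lambda>(B, \<gamma>) i.
     let rest = rename Old (drop (Suc i) \<gamma>) @ NT (Around B) # rename Old (take i \<gamma>)
     in case \<gamma> ! i of NT A \<Rightarrow> (Around A, rest) | Tm c \<Rightarrow> (Cut, Tm c # rest))"

definition cyclic_prods :: "('n, 't) prods \<Rightarrow> 'n \<Rightarrow> ('n cyc, 't) prods" where
  "cyclic_prods P S =
     (\<lambda>(A, \<alpha>). (Old A, rename Old \<alpha>)) ` P \<union> {(Around S, [])} \<union>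
     (\<Union>p \<in> P. turn p ` {..<length (snd p)}) \<union>
     {p. p = (Cut, []) \<and> yields P [NT S] []}"

lemma turned_NT:
  "(B, \<alpha> @ NT A # \<beta>) \<in> P \<Longrightarrow>
    (Around A, rename Old \<beta> @ NT (Around B) # rename Old \<alpha>) \<in> cyclic_prods P S"
  unfolding cyclic_prods_def
  by (auto simp: turn_def nth_append intro!: bexI[of _ "(B, \<alpha> @ NT A # \<beta>)"]
      image_eqI[of _ _ "length \<alpha>"])

lemma turned_Tm:
  "(B, \<alpha> @ Tm c # \<beta>) \<in> P \<Longrightarrow>
    (Cut, Tm c # rename Old \<beta> @ NT (Around B) # rename Old \<alpha>) \<in> cyclic_prods P S"
  unfolding cyclic_prods_def
  by (auto simp: turn_def nth_append intro!: bexI[of _ "(B, \<alpha> @ Tm c # \<beta>)"]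
      image_eqI[of _ _ "length \<alpha>"])

lemma cyclic_prods_cases:
  assumes "(Z, \<gamma>) \<in> cyclic_prods P S"
  obtains (old) A \<alpha> where "(A, \<alpha>) \<in> P" "Z = Old A" "\<gamma> = rename Old \<alpha>"
  | (stop) "Z = Around S" "\<gamma> = []"
  | (around) B \<alpha> A \<beta> where "(B, \<alpha> @ NT A # \<beta>) \<in> P" "Z = Around A"
      "\<gamma> = rename Old \<beta> @ NT (Around B) # rename Old \<alpha>"
  | (cut) B \<alpha> c \<beta> where "(B, \<alpha> @ Tm c # \<beta>) \<in> P" "Z = Cut"
      "\<gamma> = Tm c # rename Old \<beta> @ NT (Around B) # rename Old \<alpha>"
  | (empty) "yields P [NT S] []" "Z = Cut" "\<gamma> = []"
proof -
  from assms consider "(Z, \<gamma>) \<in> (\<lambda>(A, \<alpha>). (Old A, rename Old \<alpha>)) ` P"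
    | "Z = Around S" "\<gamma> = []"
    | B \<delta> i where "(B, \<delta>) \<in> P" "i < length \<delta>" "(Z, \<gamma>) = turn (B, \<delta>) i"
    | "yields P [NT S] []" "Z = Cut" "\<gamma> = []"
    unfolding cyclic_prods_def by force
  then show thesis
  proof cases
    case 3
    have split: "\<delta> = take i \<delta> @ \<delta> ! i # drop (Suc i) \<delta>"
      using 3(2) by (simp add: id_take_nth_drop)
    show thesis
    proof (cases "\<delta> ! i")
      case (NT A)
      with 3 split show thesis
        by (intro around[of B "take i \<delta>" A "drop (Suc i) \<delta>"]) (auto simp: turn_def)
    next
      case (Tm c)
      with 3 split show thesis
        by (intro cut[of B "take i \<delta>" c "drop (Suc i) \<delta>"]) (auto simp: turn_def)
    qed
  qed (use old stop empty in auto)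
qed

fun cyclic_lang :: "('n, 't) prods \<Rightarrow> 'n \<Rightarrow> 'n cyc \<Rightarrow> 't list set" where
  "cyclic_lang P S (Old A) = {w. yields P [NT A] w}"
| "cyclic_lang P S (Around A) = {v @ u | u v. surrounds P S A u v}"
| "cyclic_lang P S Cut = {v @ u | u v. yields P [NT S] (u @ v)}"

lemma sem_cyclic_lang_Old: "sem (cyclic_lang P S) (rename Old \<gamma>) = {w. yields P \<gamma> w}"
proof -
  have "cyclic_lang P S \<circ> Old = (\<lambda>A. {w. yields P [NT A] w})" by (simp add: fun_eq_iff)
  then show ?thesis by (simp only: sem_rename sem_yields)
qed

text \<open>Soundness: the intended languages satisfy the inequations of the turned grammar.\<close>

lemma cyclic_lang_closed:
  assumes "(Z, \<gamma>) \<in> cyclic_prods P S"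
  shows "sem (cyclic_lang P S) \<gamma> \<subseteq> cyclic_lang P S Z"
  using assms
proof (cases rule: cyclic_prods_cases)
  case (old A \<alpha>)
  then show ?thesis by (auto simp: sem_cyclic_lang_Old yields_NT_single)
next
  case stop
  then show ?thesis using surrounds.start[of P S] by auto
next
  case (around B \<alpha> A \<beta>)
  show ?thesis
  proof
    fix w assume "w \<in> sem (cyclic_lang P S) \<gamma>"
    then obtain x y u v where w: "w = y @ (v @ u) @ x"
      and d: "yields P \<alpha> x" "yields P \<beta> y" "surrounds P S B u v"
      by (auto simp: around sem_append sem_cyclic_lang_Old)
    from surrounds.step[OF d(3) around(1) d(1,2)] have "surrounds P S A (u @ x) (y @ v)" .
    moreover have "w = (y @ v) @ (u @ x)" using w by simp
    ultimately show "w \<in> cyclic_lang P S Z"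
      unfolding around(2) cyclic_lang.simps by blast
  qed
next
  case (cut B \<alpha> c \<beta>)
  show ?thesis
  proof
    fix w assume "w \<in> sem (cyclic_lang P S) \<gamma>"
    then obtain x y u v where w: "w = c # y @ (v @ u) @ x"
      and d: "yields P \<alpha> x" "yields P \<beta> y" "surrounds P S B u v"
      by (auto simp: cut sem_append sem_cyclic_lang_Old)
    have "yields P (\<alpha> @ Tm c # \<beta>) (x @ c # y)" using d by (auto simp: yields_simps)
    then have "yields P [NT B] (x @ c # y)" using cut(1) yields_NT_single by metis
    with surrounds_yields[OF d(3) this] have "yields P [NT S] ((u @ x) @ (c # y @ v))" by simp
    moreover have "w = (c # y @ v) @ (u @ x)" using w by simp
    ultimately show "w \<in> cyclic_lang P S Z"
      unfolding cut(2) cyclic_lang.simps by blast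
  qed
next
  case empty
  have "[] \<in> cyclic_lang P S Cut"
    unfolding cyclic_lang.simps
    using empty(1) by (metis (mono_tags, lifting) append_Nil mem_Collect_eq)
  then show ?thesis unfolding empty(2,3) sem.simps by blast
qed

lemma yields_Old: "yields P \<gamma> w \<Longrightarrow> yields (cyclic_prods P S) (rename Old \<gamma>) w"
  by (rule yields_rename) (auto simp: cyclic_prods_def)

lemma yields_turned:
  assumes "yields P \<alpha> x" and "yields P \<beta> y" and "yields (cyclic_prods P S) [NT (Around B)] z"
  shows "yields (cyclic_prods P S) (rename Old \<beta> @ NT (Around B) # rename Old \<alpha>) (y @ z @ x)"
  using yields_appendI[OF yields_Old[OF assms(2)]
      yields_appendI[OF assms(3) yields_Old[OF assms(1)]]] by simp

lemma yields_Around: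
  "surrounds P S A u v \<Longrightarrow> yields (cyclic_prods P S) [NT (Around A)] (v @ u)"
proof (induction rule: surrounds.induct)
  case start
  have "(Around S, []) \<in> cyclic_prods P S" by (simp add: cyclic_prods_def)
  then show ?case by (auto simp: yields_NT_single intro: yields.Nil)
next
  case (step B u v \<alpha> A \<beta> x y)
  let ?Q = "cyclic_prods P S"
  have "yields ?Q (rename Old \<beta> @ NT (Around B) # rename Old \<alpha>) (y @ (v @ u) @ x)"
    using yields_turned[OF step.hyps(3,4) step.IH] .
  with turned_NT[OF step.hyps(2)] have "yields ?Q [NT (Around A)] (y @ (v @ u) @ x)"
    by (rule yields_NT_singleI)
  then show ?case by simp
qed

lemma yields_Cut:
  "yields (cyclic_prods P S) [NT Cut] w \<longleftrightarrow> (\<exists>u v. w = v @ u \<and> yields P [NT S] (u @ v))"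
proof
  let ?Q = "cyclic_prods P S"
  assume "yields ?Q [NT Cut] w"
  from yields_sem[OF cyclic_lang_closed this]
  show "\<exists>u v. w = v @ u \<and> yields P [NT S] (u @ v)" by auto
next
  let ?Q = "cyclic_prods P S"
  assume "\<exists>u v. w = v @ u \<and> yields P [NT S] (u @ v)"
  then obtain u v where w: "w = v @ u" and L: "yields P [NT S] (u @ v)" by auto
  show "yields ?Q [NT Cut] w"
  proof (cases w)
    case Nil
    with w L have "(Cut, []) \<in> ?Q" by (auto simp: cyclic_prods_def)
    then show ?thesis using Nil by (auto simp: yields_NT_single intro: yields.Nil)
  next
    case (Cons c w')
    \<comment> \<open>Rotating by the empty word and by the whole word is the same, so the part that comes to
      the front may be taken to be non-empty.\<close>
    obtain x y where xy: "w = (c # y) @ x" "yields P [NT S] (x @ c # y)"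
    proof (cases v)
      case Nil
      then show thesis using that[of w' "[]"] w L Cons by simp
    next
      case (Cons d v')
      then show thesis using that[of v' u] w L \<open>w = c # w'\<close> by simp
    qed
    then obtain \<gamma> where \<gamma>: "(S, [] @ \<gamma> @ []) \<in> P" "yields P \<gamma> (x @ c # y)"
      by (auto simp: yields_NT_single)
    from locate_letter[OF \<gamma>(2) surrounds.start \<gamma>(1) yields.Nil yields.Nil]
    obtain B \<alpha> \<beta> u' v' x' y' where s: "surrounds P S B u' v'" "(B, \<alpha> @ Tm c # \<beta>) \<in> P"
      "yields P \<alpha> x'" "yields P \<beta> y'" "x = u' @ x'" "y = y' @ v'"
      by auto
    have "yields ?Q (rename Old \<beta> @ NT (Around B) # rename Old \<alpha>) (y' @ (v' @ u') @ x')"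
      using yields_turned[OF s(3,4) yields_Around[OF s(1)]] .
    from yields.Tm[OF this, of c]
    have "yields ?Q (Tm c # rename Old \<beta> @ NT (Around B) # rename Old \<alpha>) w"
      using xy(1) s(5,6) by simp
    with turned_Tm[OF s(2)] show ?thesis by (rule yields_NT_singleI)
  qed
qed

text \<open>Derivation trees turned inside out: the tree of \<open>u @ v\<close> is rerooted at the leaf that carries the
first letter of \<open>v\<close>.\<close>

lemma context_free_cyclic_closure:
  assumes "context_free \<Sigma> L"
  shows "context_free \<Sigma> {v @ u | u v. u @ v \<in> L}"
proof -
  from assms obtain P :: "(nat, 'a) prods" and S where P: "finite \<Sigma>" "finite P"
    and terminals: "\<forall>(A, \<alpha>) \<in> P. set \<alpha> \<subseteq> range NT \<union> Tm ` \<Sigma>" and L: "L = cfg_lang P S"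
    unfolding context_free_def by (elim conjE exE)
  have productions: "set (rename Old \<alpha>) \<subseteq> range NT \<union> Tm ` \<Sigma>" if "(A, \<alpha>) \<in> P" for A \<alpha>
    using that terminals by (intro terminals_rename) auto
  show ?thesis
  proof (rule context_freeI[where P = "cyclic_prods P S" and S = Cut])
    show "finite (cyclic_prods P S)"
      unfolding cyclic_prods_def using P(2) by auto
    show "set \<gamma> \<subseteq> range NT \<union> Tm ` \<Sigma>" if "(Z, \<gamma>) \<in> cyclic_prods P S" for Z \<gamma>
      using that
    proof (cases rule: cyclic_prods_cases)
      case (old A \<alpha>)
      with productions show ?thesis by simp
    next
      case (around B \<alpha> A \<beta>)
      with productions[OF around(1)] show ?thesis by simp
    next
      case (cut B \<alpha> c \<beta>)
      with productions[OF cut(1)] show ?thesis by simp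
    qed simp_all
    show "{v @ u | u v. u @ v \<in> L} = {w. yields (cyclic_prods P S) [NT Cut] w}"
      by (simp add: yields_Cut L cfg_lang_yields)
  qed (use P in auto)
qed

section \<open>One-counter actions\<close>

text \<open>The nonterminals for an action in which every vertex has a level, the counter. \<open>Loop v v'\<close> generates the words that take
\<open>v\<close> to a vertex \<open>v'\<close> of the same level and never go below this level. \<open>High v\<close> generates the words
whose trajectory from \<open>v\<close>, a vertex of level \<open>1\<close>, avoids level \<open>0\<close>. \<open>Begin\<close> is the
start symbol.\<close>

datatype 'v counter_nt = Loop 'v 'v | High 'v | Begin

instance counter_nt :: (countable) countable
  by countable_datatype

text \<open>A deterministic one-counter machine without the machine: letters act on vertices, each changing the
level by at most one, and above level \<open>0\<close> the action commutes with the map \<open>up\<close> that raises the level.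
So the trajectories from level \<open>2\<close> that stay above level \<open>1\<close> are copies of those from level \<open>1\<close> that
stay above level \<open>0\<close>, and the finitely many vertices of levels \<open>0\<close> and \<open>1\<close> suffice as indices of nonterminals.\<close>

locale counter_action =
  fixes \<Sigma> :: "'c set" and V :: "'v :: countable set" and act :: "'c \<Rightarrow> 'v \<Rightarrow> 'v"
    and lev :: "'v \<Rightarrow> nat" and up :: "'v \<Rightarrow> 'v"
  assumes finite_alphabet: "finite \<Sigma>"
    and finite_low: "finite {v \<in> V. lev v \<le> 1}"
    and act_closed: "c \<in> \<Sigma> \<Longrightarrow> v \<in> V \<Longrightarrow> act c v \<in> V"
    and lev_act_le: "c \<in> \<Sigma> \<Longrightarrow> v \<in> V \<Longrightarrow> lev (act c v) \<le> Suc (lev v)"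
    and lev_le_act: "c \<in> \<Sigma> \<Longrightarrow> v \<in> V \<Longrightarrow> lev v \<le> Suc (lev (act c v))"
    and lev_up: "v \<in> V \<Longrightarrow> lev (up v) = Suc (lev v)"
    and up_surj: "v \<in> V \<Longrightarrow> lev v = 2 \<Longrightarrow> \<exists>u \<in> V. lev u = 1 \<and> v = up u"
    and act_up: "c \<in> \<Sigma> \<Longrightarrow> v \<in> V \<Longrightarrow> 1 \<le> lev v \<Longrightarrow> act c (up v) = up (act c v)"
begin

definition run :: "'c list \<Rightarrow> 'v \<Rightarrow> 'v" where
  "run w v = foldr act w v"

lemma run_simps [simp]:
  "run [] v = v" "run (c # w) v = act c (run w v)" "run (u @ w) v = run u (run w v)"
  by (simp_all add: run_def)

lemma run_closed: "w \<in> lists \<Sigma> \<Longrightarrow> v \<in> V \<Longrightarrow> run w v \<in> V"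
  by (induction w) (auto intro: act_closed)

fun above :: "nat \<Rightarrow> 'c list \<Rightarrow> 'v \<Rightarrow> bool" where
  "above h [] v \<longleftrightarrow> h \<le> lev v"
| "above h (c # w) v \<longleftrightarrow> above h w v \<and> h \<le> lev (act c (run w v))"

lemma above_end: "above h w v \<Longrightarrow> h \<le> lev (run w v)"
  by (cases w) auto

lemma above_append: "above h (u @ w) v \<longleftrightarrow> above h w v \<and> above h u (run w v)"
  by (induction u) (auto dest: above_end)

lemma above_mono: "above h w v \<Longrightarrow> g \<le> h \<Longrightarrow> above g w v"
  by (induction w) auto

lemma above_0: "above 0 w v"
  by (induction w) auto

lemma above_start: "above h w v \<Longrightarrow> h \<le> lev v"
  by (induction w) auto

text \<open>An excursion above a base level \<open>b \<le> 1\<close> starts at level \<open>Suc b\<close>. It is described by a vertex of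
level \<open>1\<close>, which has to be raised if \<open>b = 1\<close> and is the actual vertex if \<open>b = 0\<close>.\<close>

definition lift :: "nat \<Rightarrow> 'v \<Rightarrow> 'v" where
  "lift b v = (if b = 0 then v else up v)"

lemma run_lift:
  assumes "w \<in> lists \<Sigma>" "v \<in> V" "above 1 w v" "b \<le> 1"
  shows "run w (lift b v) = lift b (run w v) \<and> above (Suc b) w (lift b v)"
proof (cases "b = 0")
  case False
  with \<open>b \<le> 1\<close> have "b = 1" by simp
  have "run w (up v) = up (run w v) \<and> above 2 w (up v)"
    using assms(1,3)
  proof (induction w rule: list.induct)
    case Nil
    then show ?case using \<open>v \<in> V\<close> by (simp add: lev_up)
  next
    case (Cons c w)
    then have IH: "run w (up v) = up (run w v)" "above 2 w (up v)" by auto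
    have w: "w \<in> lists \<Sigma>" "c \<in> \<Sigma>" using Cons.prems(1) by auto
    then have V: "run w v \<in> V" "act c (run w v) \<in> V"
      using run_closed \<open>v \<in> V\<close> act_closed by blast+
    moreover have "1 \<le> lev (run w v)" using Cons.prems above_end by auto
    ultimately have "act c (up (run w v)) = up (act c (run w v))"
      using w(2) by (intro act_up)
    then show ?case using IH V Cons.prems by (simp add: lev_up)
  qed
  then show ?thesis using \<open>b = 1\<close> by (simp add: lift_def numeral_2_eq_2)
qed (use assms in \<open>simp add: lift_def\<close>)

lemma above_of_lift:
  assumes "w \<in> lists \<Sigma>" "v \<in> V" "above (Suc b) w (lift b v)" "b \<le> 1"
  shows "above 1 w v"
  using assms(1,3)
proof (induction w rule: list.induct)
  case Nil
  then show ?case using assms(2,4) by (auto simp: lift_def lev_up split: if_splits)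
next
  case (Cons c w)
  then have 1: "above 1 w v" and w: "w \<in> lists \<Sigma>" "c \<in> \<Sigma>" by auto
  have V: "run w v \<in> V" using run_closed w assms(2) by blast
  have lift: "run w (lift b v) = lift b (run w v)" using run_lift[OF w(1) assms(2) 1 assms(4)] by blast
  have "act c (lift b (run w v)) = lift b (act c (run w v))"
    using act_up[OF w(2) V] above_end[OF 1] by (simp add: lift_def)
  then have "Suc b \<le> lev (lift b (act c (run w v)))" using Cons.prems(2) lift by simp
  then have "1 \<le> lev (act c (run w v))"
    using lev_up[OF act_closed[OF w(2) V]] assms(4) by (auto simp: lift_def split: if_splits)
  with 1 show ?case by simp
qed

text \<open>A trajectory that ends above level \<open>h\<close> is cut at its last passage from \<open>h\<close> to \<open>Suc h\<close>. Levels cannot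
be skipped, so there is such a passage, and what follows it stays above.\<close>

lemma last_crossing:
  assumes "w \<in> lists \<Sigma>" "v \<in> V" "lev v \<le> h" "h < lev (run w v)"
  shows "\<exists>w2 c w1. w = w2 @ c # w1 \<and> lev (run w1 v) = h \<and> lev (act c (run w1 v)) = Suc h \<and>
    above (Suc h) w2 (act c (run w1 v))"
  using assms(1,4)
proof (induction w rule: list.induct)
  case Nil
  then show ?case using assms(3) by simp
next
  case (Cons c w)
  show ?case
  proof (cases "lev (run w v) \<le> h")
    case True
    moreover have "w \<in> lists \<Sigma>" "c \<in> \<Sigma>" using Cons.prems(1) by auto
    then have "lev (run (c # w) v) \<le> Suc (lev (run w v))"
      using run_closed[of w v] assms(2) by (simp add: lev_act_le)
    ultimately show ?thesis using Cons.prems(2)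
      by (intro exI[of _ "[]"] exI[of _ c] exI[of _ w]) auto
  next
    case False
    with Cons obtain w2 d w1 where w: "w = w2 @ d # w1" "lev (run w1 v) = h"
      "lev (act d (run w1 v)) = Suc h" "above (Suc h) w2 (act d (run w1 v))" by auto
    then show ?thesis using Cons.prems(2)
      by (intro exI[of _ "c # w2"] exI[of _ d] exI[of _ w1]) auto
  qed
qed

abbreviation low :: "'v set" where
  "low \<equiv> {v \<in> V. lev v \<le> 1}"

text \<open>The productions follow the trajectory backwards, as the first letter of a word acts last. A loop is
trivial, or its last step stays on the base level (\<open>along\<close>), or its last step comes down from an
excursion that starts at the last crossing of the base level and is a loop one
level higher (\<open>bump\<close>). A word in \<open>High v\<close> ends at level \<open>1\<close> or has a last crossing of level \<open>1\<close>, after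
which it behaves like a word in \<open>High y\<close> (\<open>climb\<close>). A word moves a vertex \<open>p\<close> of level
\<open>0\<close> if it ends at another vertex of level \<open>0\<close>, or if it ends at a higher level (\<open>escape\<close>).\<close>

inductive_set prods :: "('v counter_nt, 'c) prods" where
  stay: "v \<in> low \<Longrightarrow> (Loop v v, []) \<in> prods"
| along: "\<lbrakk>v \<in> low; u \<in> low; c \<in> \<Sigma>; act c u \<in> low; lev u = lev v; lev (act c u) = lev v\<rbrakk>
    \<Longrightarrow> (Loop v (act c u), [Tm c, NT (Loop v u)]) \<in> prods"
| bump: "\<lbrakk>v \<in> low; v' \<in> low; x \<in> low; y \<in> low; t \<in> low; c \<in> \<Sigma>; d \<in> \<Sigma>; lev v' = lev v; lev t = lev v;
      lev x = 1; lev y = 1; act d t = lift (lev v) x; act c (lift (lev v) y) = v'\<rbrakk>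
    \<Longrightarrow> (Loop v v', [Tm c, NT (Loop x y), Tm d, NT (Loop v t)]) \<in> prods"
| level: "\<lbrakk>v \<in> low; v' \<in> low; lev v = 1; lev v' = 1\<rbrakk> \<Longrightarrow> (High v, [NT (Loop v v')]) \<in> prods"
| climb: "\<lbrakk>v \<in> low; y \<in> low; t \<in> low; d \<in> \<Sigma>; lev v = 1; lev t = 1; lev y = 1; act d t = up y\<rbrakk>
    \<Longrightarrow> (High v, [NT (High y), Tm d, NT (Loop v t)]) \<in> prods"
| moved: "\<lbrakk>p \<in> low; q \<in> low; lev p = 0; lev q = 0; p \<noteq> q\<rbrakk> \<Longrightarrow> (Begin, [NT (Loop p q)]) \<in> prods"
| escape: "\<lbrakk>p \<in> low; y \<in> low; t \<in> low; d \<in> \<Sigma>; lev p = 0; lev t = 0; lev y = 1; act d t = y\<rbrakk>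
    \<Longrightarrow> (Begin, [NT (High y), Tm d, NT (Loop p t)]) \<in> prods"

lemma prods_bounded:
  defines "nts \<equiv> insert Begin (High ` low \<union> case_prod Loop ` (low \<times> low))"
  shows "prods \<subseteq> nts \<times> {\<alpha>. set \<alpha> \<subseteq> NT ` nts \<union> Tm ` \<Sigma> \<and> length \<alpha> \<le> 4}"
proof -
  have "A \<in> nts \<and> set \<alpha> \<subseteq> NT ` nts \<union> Tm ` \<Sigma> \<and> length \<alpha> \<le> 4" if "(A, \<alpha>) \<in> prods" for A \<alpha>
    using that by cases (auto simp: nts_def image_iff)
  then show ?thesis by auto
qed

lemma finite_prods: "finite prods"
  by (rule finite_subset[OF prods_bounded])
    (intro finite_cartesian_product finite_lists_length_le finite_insert[THEN iffD2] finite_UnI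
      finite_imageI finite_low finite_alphabet)

text \<open>The interpretation of the nonterminals that is to be shown equal to the generated languages.\<close>

fun lang :: "'v counter_nt \<Rightarrow> 'c list set" where
  "lang (Loop v v') = {w \<in> lists \<Sigma>. run w v = v' \<and> above (lev v) w v}"
| "lang (High v) = {w \<in> lists \<Sigma>. above 1 w v}"
| "lang Begin = {w \<in> lists \<Sigma>. \<exists>p \<in> V. lev p = 0 \<and> run w p \<noteq> p}"

lemma lang_closed:
  assumes "(A, \<alpha>) \<in> prods"
  shows "sem lang \<alpha> \<subseteq> lang A"
  using assms
proof cases
  case (bump v v' x y t c d)
  have "lev v \<le> 1" using bump by simp
  have "c # w2 @ d # w1 \<in> lang A"
    if w1: "w1 \<in> lang (Loop v t)" and w2: "w2 \<in> lang (Loop x y)" for w1 w2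
  proof -
    have "run w2 (lift (lev v) x) = lift (lev v) y \<and> above (Suc (lev v)) w2 (lift (lev v) x)"
      using run_lift[of w2 x "lev v"] w2 bump \<open>lev v \<le> 1\<close> by auto
    moreover have "above (lev v) w2 (lift (lev v) x)"
      using calculation above_mono by (meson le_Suc_eq order_refl)
    ultimately show ?thesis
      using w1 w2 bump above_start[of "lev v" w2 "lift (lev v) x"] by (auto simp: above_append)
  qed
  then show ?thesis unfolding bump(2) by (auto simp del: lang.simps)
next
  case (climb v y t d)
  have "w2 @ d # w1 \<in> lang A" if w1: "w1 \<in> lang (Loop v t)" and w2: "w2 \<in> lang (High y)" for w1 w2
  proof -
    have "above 2 w2 (up y)"
      using run_lift[of w2 y 1] w2 climb by (auto simp: lift_def numeral_2_eq_2)
    then have "above 1 w2 (up y)" by (rule above_mono) simp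
    then show ?thesis
      using w1 w2 climb above_start[of 1 w2 "up y"] by (auto simp: above_append)
  qed
  then show ?thesis unfolding climb(2) by (auto simp del: lang.simps)
next
  case (escape p y t d)
  have "w2 @ d # w1 \<in> lang A" if w1: "w1 \<in> lang (Loop p t)" and w2: "w2 \<in> lang (High y)" for w1 w2
  proof -
    have "1 \<le> lev (run w2 y)" using w2 by (auto dest: above_end)
    then have "run w2 y \<noteq> p" using escape by auto
    then show ?thesis using w1 w2 escape by (auto intro!: bexI[of _ p])
  qed
  then show ?thesis unfolding escape(2) by (auto simp del: lang.simps)
qed auto

text \<open>Completeness. The two shorter loops to which \<open>bump\<close> reduces a word are found by
\<open>last_crossing\<close>, and the excursion is brought down to level \<open>1\<close> by \<open>above_of_lift\<close>.\<close>

lemma yields_Loop: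
  assumes "w \<in> lists \<Sigma>" "v \<in> low" "lev (run w v) = lev v" "above (lev v) w v"
  shows "yields prods [NT (Loop v (run w v))] w"
  using assms
proof (induction w arbitrary: v rule: length_induct)
  case (1 w)
  note prems = "1.prems" and IH = "1.IH"[rule_format]
  show ?case
  proof (cases w)
    case Nil
    have "(Loop v v, []) \<in> prods" using prems(2) by (intro stay) auto
    then show ?thesis using Nil by (auto intro: yields_NT_singleI yields.Nil)
  next
    case (Cons c w')
    let ?u = "run w' v"
    have w': "w' \<in> lists \<Sigma>" "c \<in> \<Sigma>" "above (lev v) w' v" using prems Cons by auto
    have V: "v \<in> V" "lev v \<le> 1" using prems(2) by auto
    have uV: "?u \<in> V" "act c ?u \<in> V" using V(1) run_closed w' act_closed by blast+
    have lev_u: "lev v \<le> lev ?u" "lev ?u \<le> Suc (lev v)"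
      using above_end[OF w'(3)] lev_le_act[OF w'(2) uV(1)] prems(3) Cons by auto
    show ?thesis
    proof (cases "lev ?u = lev v")
      case True
      then have "yields prods [NT (Loop v ?u)] w'"
        using IH[of w' v] w' prems(2) Cons by simp
      from yields.Tm[OF this, of c] have "yields prods [Tm c, NT (Loop v ?u)] w"
        using Cons by simp
      moreover have "(Loop v (act c ?u), [Tm c, NT (Loop v ?u)]) \<in> prods"
        using prems(2,3) Cons V uV True w' by (intro along) auto
      ultimately show ?thesis using Cons by (auto intro: yields_NT_singleI)
    next
      case False
      with lev_u have high: "lev ?u = Suc (lev v)" by simp
      obtain w2 d w1 where split: "w' = w2 @ d # w1" and t: "lev (run w1 v) = lev v"
        and z: "lev (act d (run w1 v)) = Suc (lev v)"
        and top: "above (Suc (lev v)) w2 (act d (run w1 v))"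
        using last_crossing[OF w'(1) V(1) order_refl] high by auto
      have w12: "w1 \<in> lists \<Sigma>" "w2 \<in> lists \<Sigma>" "d \<in> \<Sigma>" using w'(1) split by auto
      let ?t = "run w1 v"
      have tV: "?t \<in> V" "act d ?t \<in> V" using run_closed act_closed w12 V(1) by blast+
      obtain x where x: "x \<in> V" "lev x = 1" "act d ?t = lift (lev v) x"
      proof (cases "lev v = 0")
        case True
        then show thesis using that[of "act d ?t"] tV z by (simp add: lift_def)
      next
        case False
        then show thesis using up_surj[OF tV(2)] z V(2) that by (auto simp: lift_def)
      qed
      let ?y = "run w2 x"
      have above1: "above 1 w2 x" using above_of_lift[of w2 x "lev v"] w12(2) x top V(2) by simp
      have lift: "?u = lift (lev v) ?y"
        using run_lift[OF w12(2) x(1) above1 V(2)] x(3) split by simp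
      have yV: "?y \<in> V" using run_closed w12(2) x(1) by blast
      have y: "lev ?y = 1"
        using high lift lev_up[OF yV] V(2) by (auto simp: lift_def split: if_splits)
      have inner: "yields prods [NT (Loop x ?y)] w2"
        using IH[of w2 x] w12 x y above1 Cons split by simp
      have outer: "yields prods [NT (Loop v ?t)] w1"
        using IH[of w1 v] w12 prems(2) t w'(3) Cons split by (simp add: above_append)
      have "yields prods [Tm c, NT (Loop x ?y), Tm d, NT (Loop v ?t)] (c # w2 @ d # w1)"
        using yields.Tm[OF yields_appendI[OF inner yields.Tm[OF outer]]] by simp
      moreover have "(Loop v (act c ?u), [Tm c, NT (Loop x ?y), Tm d, NT (Loop v ?t)]) \<in> prods"
        using prems(2,3) Cons V uV w' w12 x y yV tV t lift by (intro bump) auto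
      ultimately have "yields prods [NT (Loop v (act c ?u))] (c # w2 @ d # w1)"
        by (intro yields_NT_singleI)
      then show ?thesis using Cons split by simp
    qed
  qed
qed

lemma yields_High:
  assumes "w \<in> lists \<Sigma>" "v \<in> low" "lev v = 1" "above 1 w v"
  shows "yields prods [NT (High v)] w"
  using assms
proof (induction w arbitrary: v rule: length_induct)
  case (1 w)
  note prems = "1.prems" and IH = "1.IH"[rule_format]
  have V: "v \<in> V" using prems(2) by simp
  then have wV: "run w v \<in> V" using prems(1) run_closed by blast
  show ?case
  proof (cases "lev (run w v) = 1")
    case True
    then have "yields prods [NT (Loop v (run w v))] w" using yields_Loop prems by simp
    moreover have "(High v, [NT (Loop v (run w v))]) \<in> prods"
      using prems V wV True by (intro level) auto
    ultimately show ?thesis by (rule yields_NT_singleI[rotated])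
  next
    case False
    then have "1 < lev (run w v)" using above_end[OF prems(4)] by simp
    then obtain w2 d w1 where split: "w = w2 @ d # w1" and t: "lev (run w1 v) = 1"
      and z: "lev (act d (run w1 v)) = 2" and top: "above 2 w2 (act d (run w1 v))"
      using last_crossing[OF prems(1) V, of 1] prems(3) by (auto simp: numeral_2_eq_2)
    have w12: "w1 \<in> lists \<Sigma>" "w2 \<in> lists \<Sigma>" "d \<in> \<Sigma>" using prems(1) split by auto
    let ?t = "run w1 v"
    have tV: "?t \<in> V" "act d ?t \<in> V" using run_closed act_closed w12 V by blast+
    obtain y where y: "y \<in> V" "lev y = 1" "act d ?t = up y"
      using up_surj[OF tV(2) z] by auto
    have "above 1 w2 y"
      using above_of_lift[of w2 y 1] w12(2) y top by (simp add: lift_def numeral_2_eq_2)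
    then have inner: "yields prods [NT (High y)] w2"
      using IH[of w2 y] w12 y split by simp
    have outer: "yields prods [NT (Loop v ?t)] w1"
      using yields_Loop[of w1 v] w12 prems t split by (simp add: above_append)
    have "yields prods [NT (High y), Tm d, NT (Loop v ?t)] w"
      using yields_appendI[OF inner yields.Tm[OF outer]] split by simp
    moreover have "(High v, [NT (High y), Tm d, NT (Loop v ?t)]) \<in> prods"
      using prems y tV t w12 by (intro climb) auto
    ultimately show ?thesis by (rule yields_NT_singleI[rotated])
  qed
qed

lemma yields_Begin:
  assumes "w \<in> lists \<Sigma>" "p \<in> V" "lev p = 0" "run w p \<noteq> p"
  shows "yields prods [NT Begin] w"
proof (cases "lev (run w p) = 0")
  case True
  then have "yields prods [NT (Loop p (run w p))] w"
    using yields_Loop[of w p] assms above_0 by simp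
  moreover have "(Begin, [NT (Loop p (run w p))]) \<in> prods"
    using assms True run_closed[OF assms(1,2)] by (intro moved) auto
  ultimately show ?thesis by (rule yields_NT_singleI[rotated])
next
  case False
  then obtain w2 d w1 where split: "w = w2 @ d # w1" and t: "lev (run w1 p) = 0"
    and z: "lev (act d (run w1 p)) = 1" and top: "above 1 w2 (act d (run w1 p))"
    using last_crossing[OF assms(1,2), of 0] assms(3) by auto
  have w12: "w1 \<in> lists \<Sigma>" "w2 \<in> lists \<Sigma>" "d \<in> \<Sigma>" using assms(1) split by auto
  let ?t = "run w1 p"
  have tV: "?t \<in> V" "act d ?t \<in> V" using run_closed act_closed w12 assms(2) by blast+
  have inner: "yields prods [NT (High (act d ?t))] w2"
    using yields_High[of w2 "act d ?t"] w12 z top tV by simp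
  have outer: "yields prods [NT (Loop p ?t)] w1"
    using yields_Loop[of w1 p] w12 assms t above_0 by simp
  have "yields prods [NT (High (act d ?t)), Tm d, NT (Loop p ?t)] w"
    using yields_appendI[OF inner yields.Tm[OF outer]] split by simp
  moreover have "(Begin, [NT (High (act d ?t)), Tm d, NT (Loop p ?t)]) \<in> prods"
    using assms tV t z w12 by (intro escape) auto
  ultimately show ?thesis by (rule yields_NT_singleI[rotated])
qed

theorem context_free_low_moves:
  "context_free \<Sigma> {w \<in> lists \<Sigma>. \<exists>p \<in> V. lev p = 0 \<and> run w p \<noteq> p}"
proof (rule context_freeI[where P = prods and S = Begin])
  show "set \<alpha> \<subseteq> range NT \<union> Tm ` \<Sigma>" if "(A, \<alpha>) \<in> prods" for A \<alpha>
    using that prods_bounded by blast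
  have "sem lang [NT Begin] = lang Begin" by simp
  with yields_sem[of prods lang "[NT Begin]"] lang_closed
  have "yields prods [NT Begin] w \<Longrightarrow> w \<in> lang Begin" for w by blast
  then show "{w \<in> lists \<Sigma>. \<exists>p \<in> V. lev p = 0 \<and> run w p \<noteq> p} = {w. yields prods [NT Begin] w}"
    using yields_Begin by auto
qed (use finite_alphabet finite_prods in auto)

end

section \<open>Words acting on rays by eventual translations\<close>

text \<open>The point \<open>M\<close> beyond which all letters act as translations is chosen as large as all the translation
lengths, and so large that no vertex below \<open>M\<close> is sent to \<open>2 * M\<close> or beyond. Then the ray can
be divided into blocks of length \<open>M\<close> such that no letter skips a block, and the number of the
block is a counter.\<close>

locale ray_action =
  fixes n M :: nat and \<Sigma> :: "'c set" and act :: "'c \<Rightarrow> nat \<times> nat \<Rightarrow> nat \<times> nat" and s :: "'c \<Rightarrow> nat \<Rightarrow> int"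
  assumes M_pos: "0 < M"
    and finite_letters: "finite \<Sigma>"
    and act_bij: "c \<in> \<Sigma> \<Longrightarrow> bij_betw (act c) (ray_verts n) (ray_verts n)"
    and far: "c \<in> \<Sigma> \<Longrightarrow> l \<in> {1..n} \<Longrightarrow> M \<le> k \<Longrightarrow>
      int (fst (act c (k, l))) = int k + s c l \<and> snd (act c (k, l)) = l"
    and shift_le: "c \<in> \<Sigma> \<Longrightarrow> l \<in> {1..n} \<Longrightarrow> \<bar>s c l\<bar> \<le> int M"
    and near: "c \<in> \<Sigma> \<Longrightarrow> l \<in> {1..n} \<Longrightarrow> k < M \<Longrightarrow> fst (act c (k, l)) < 2 * M"

sublocale ray_action \<subseteq>
  counter_action \<Sigma> "ray_verts n" act "\<lambda>v. fst v div M" "\<lambda>v. (fst v + M, snd v)"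
proof
  show "finite \<Sigma>" by (rule finite_letters)
  have low: "a div M \<le> 1 \<longleftrightarrow> a < 2 * M" for a
    unfolding div_less_iff_less_mult[OF M_pos, symmetric] by auto
  have "{v \<in> ray_verts n. fst v div M \<le> 1} \<subseteq> {..<2 * M} \<times> {1..n}"
    unfolding low by (auto simp: ray_verts_def)
  then show "finite {v \<in> ray_verts n. fst v div M \<le> 1}"
    by (rule finite_subset) simp
  fix c v assume c: "c \<in> \<Sigma>" and v: "v \<in> ray_verts n"
  show "act c v \<in> ray_verts n" using act_bij[OF c] v by (rule bij_betw_apply)
  obtain k l where kl: "v = (k, l)" "l \<in> {1..n}" using v by (auto simp: ray_verts_def)
  have "fst (act c v) \<le> k + M \<and> k \<le> fst (act c v) + M" if "M \<le> k"
    using far[OF c kl(2) that] shift_le[OF c kl(2)] kl(1) by auto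
  moreover have "fst (act c v) div M \<le> 1" if "k < M"
    using near[OF c kl(2) that] kl(1) by (simp only: low)
  ultimately have *: "fst (act c v) div M \<le> (k + M) div M \<and> k div M \<le> (fst (act c v) + M) div M"
    by (cases "M \<le> k") (auto intro: div_le_mono)
  then show "fst (act c v) div M \<le> Suc (fst v div M)" "fst v div M \<le> Suc (fst (act c v) div M)"
    using kl M_pos by auto
  show "act c (fst v + M, snd v) = (fst (act c v) + M, snd (act c v))" if "1 \<le> fst v div M"
  proof -
    have "M \<le> k" using that kl(1) M_pos by (simp add: Suc_le_eq div_greater_zero_iff)
    then show ?thesis using far[OF c kl(2), of k] far[OF c kl(2), of "k + M"] kl(1)
      by (auto simp: prod_eq_iff)
  qed
next
  fix v assume v: "v \<in> ray_verts n"
  show "fst (fst v + M, snd v) div M = Suc (fst v div M)" using M_pos by simp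
  show "\<exists>u \<in> ray_verts n. fst u div M = 1 \<and> v = (fst u + M, snd u)" if "fst v div M = 2"
  proof -
    have "M \<le> fst v" using that M_pos by (metis div_less not_less zero_neq_numeral)
    then show ?thesis using v that M_pos
      by (intro bexI[of _ "(fst v - M, snd v)"]) (auto simp: ray_verts_def le_div_geq)
  qed
qed

context ray_action
begin

lemma run_bij: "w \<in> lists \<Sigma> \<Longrightarrow> bij_betw (run w) (ray_verts n) (ray_verts n)"
proof (induction w rule: list.induct)
  case (Cons c w)
  have "run (c # w) = act c \<circ> run w" by (simp add: fun_eq_iff)
  moreover have "bij_betw (run w) (ray_verts n) (ray_verts n)" "c \<in> \<Sigma>" using Cons by auto
  ultimately show ?case using bij_betw_trans act_bij by metis
qed (simp add: bij_betw_def inj_on_def)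

lemma run_inj:
  "w \<in> lists \<Sigma> \<Longrightarrow> x \<in> ray_verts n \<Longrightarrow> y \<in> ray_verts n \<Longrightarrow> run w x = run w y \<Longrightarrow> x = y"
  using run_bij[of w] by (auto simp: bij_betw_def inj_on_def)

lemma not_above_split:
  "\<not> above 1 w x \<Longrightarrow> \<exists>u v. w = u @ v \<and> fst (run v x) div M = 0"
proof (induction w)
  case (Cons c w)
  then show ?case
  proof (cases "above 1 w x")
    case True
    with Cons.prems have "fst (run (c # w) x) div M = 0" by simp
    then show ?thesis by (intro exI[of _ "[]"] exI[of _ "c # w"]) simp
  next
    case False
    with Cons.IH obtain u v where "w = u @ v" "fst (run v x) div M = 0" by auto
    then show ?thesis by (intro exI[of _ "c # u"] exI[of _ v]) simp
  qed
qed (auto intro!: exI[of _ "[]"])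

lemma run_far:
  assumes "w \<in> lists \<Sigma>" "l \<in> {1..n}" "above 1 w (k, l)"
  shows "int (fst (run w (k, l))) = int k + (\<Sum>c\<leftarrow>w. s c l) \<and> snd (run w (k, l)) = l"
  using assms(1,3)
proof (induction w rule: list.induct)
  case (Cons c w)
  then have IH: "int (fst (run w (k, l))) = int k + (\<Sum>c\<leftarrow>w. s c l)" "snd (run w (k, l)) = l"
    and c: "c \<in> \<Sigma>" by auto
  have "1 \<le> fst (run w (k, l)) div M" using Cons.prems above_end[of 1 w] by auto
  then have "M \<le> fst (run w (k, l))"
    using M_pos by (simp add: Suc_le_eq div_greater_zero_iff)
  from far[OF c assms(2) this] have "int (fst (act c (run w (k, l)))) =
      int (fst (run w (k, l))) + s c l \<and> snd (act c (run w (k, l))) = l"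
    using IH(2) by (metis prod.collapse)
  with IH(1) show ?case by simp
qed simp

text \<open>By contradiction: if no rotation moves a vertex near the origins, then every vertex whose trajectory
visits level \<open>0\<close> is fixed, for it is conjugate to a vertex near the origins that is fixed by the rotated
word. The vertices of the ray \<open>l\<close> that are no visitors are translated by a common amount \<open>S\<close>. With
\<open>K\<close> the least of them, \<open>K + S \<ge> K\<close> since the image of a non-visitor is a non-visitor, and
\<open>S \<le> 0\<close> since \<open>K\<close> is itself the image of a non-visitor.\<close>

lemma moves_near_after_rotation:
  assumes w: "w \<in> lists \<Sigma>" and x: "x \<in> ray_verts n" "run w x \<noteq> x"
  shows "\<exists>u v. w = u @ v \<and> (\<exists>p \<in> ray_verts n. fst p div M = 0 \<and> run (v @ u) p \<noteq> p)"
proof (rule ccontr)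
  assume "\<not> ?thesis"
  then have fixed: "run (v @ u) p = p"
    if "w = u @ v" "p \<in> ray_verts n" "fst p div M = 0" for u v p
    using that by blast
  have visitor: "run w y = y" if y: "y \<in> ray_verts n" "\<not> above 1 w y" for y
  proof -
    obtain u v where uv: "w = u @ v" "fst (run v y) div M = 0"
      using not_above_split[OF y(2)] by auto
    have l: "u \<in> lists \<Sigma>" "v \<in> lists \<Sigma>" using w uv(1) by auto
    have "run v (run w y) = run v y"
      using fixed[OF uv(1) run_closed[OF l(2) y(1)] uv(2)] uv(1) by simp
    then show ?thesis using run_inj[OF l(2)] run_closed[OF w] y(1) by blast
  qed
  obtain k l where kl: "x = (k, l)" "l \<in> {1..n}" using x(1) by (auto simp: ray_verts_def)
  have V: "(i, l) \<in> ray_verts n" for i using kl(2) by (simp add: ray_verts_def)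
  define S where "S = (\<Sum>c\<leftarrow>w. s c l)"
  define K where "K = (LEAST i. above 1 w (i, l))"
  have "above 1 w (k, l)" using visitor x kl(1) by blast
  then have K: "above 1 w (K, l)" and least: "above 1 w (i, l) \<Longrightarrow> K \<le> i" for i
    unfolding K_def by (auto intro: LeastI Least_le)
  let ?y = "run w (K, l)"
  have yV: "?y \<in> ray_verts n" using run_closed[OF w V] .
  have y: "int (fst ?y) = int K + S" "snd ?y = l" using run_far[OF w kl(2) K] S_def by auto
  have "above 1 w ?y"
  proof (rule ccontr)
    assume n: "\<not> above 1 w ?y"
    then have "run w ?y = ?y" using visitor yV by blast
    then have "?y = (K, l)" using run_inj[OF w yV V] by blast
    with n K show False by simp
  qed
  with least[of "fst ?y"] y have "0 \<le> S"
    by (metis add_increasing2 le_add_same_cancel1 of_nat_le_iff prod.collapse)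
  have "(K, l) \<in> run w ` ray_verts n" using run_bij[OF w] V by (simp add: bij_betw_def)
  then obtain z where z: "z \<in> ray_verts n" "run w z = (K, l)" by auto
  have "above 1 w z" using visitor[OF z(1)] z(2) K by auto
  obtain i l' where il: "z = (i, l')" "l' \<in> {1..n}" using z(1) by (auto simp: ray_verts_def)
  have "int (fst (K, l)) = int i + (\<Sum>c\<leftarrow>w. s c l') \<and> snd (K, l) = l'"
    using run_far[OF w il(2), of i] \<open>above 1 w z\<close> unfolding il(1)[symmetric] z(2) by blast
  then have "l' = l" "int K = int i + S" unfolding S_def by auto
  moreover have "K \<le> i" using least \<open>above 1 w z\<close> il(1) \<open>l' = l\<close> by blast
  ultimately have "S = 0" using \<open>0 \<le> S\<close> by simp
  with run_far[OF w kl(2) \<open>above 1 w (k, l)\<close>] S_def have "run w x = x"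
    unfolding kl(1) by (simp add: prod_eq_iff)
  with x(2) show False by simp
qed

text \<open>Moving a vertex is invariant under rotation of the word, since rotations are conjugate. So the words
that move something are exactly the rotations of those that move a vertex of level \<open>0\<close>.\<close>

theorem context_free_moving_words:
  "context_free \<Sigma> {w \<in> lists \<Sigma>. \<exists>x \<in> ray_verts n. run w x \<noteq> x}"
proof -
  let ?L = "{w \<in> lists \<Sigma>. \<exists>p \<in> ray_verts n. fst p div M = 0 \<and> run w p \<noteq> p}"
  have "w \<in> {v @ u | u v. u @ v \<in> ?L}"
    if w: "w \<in> lists \<Sigma>" "x \<in> ray_verts n" "run w x \<noteq> x" for w x
  proof -
    obtain u v p where uv: "w = u @ v" and p: "p \<in> ray_verts n" "fst p div M = 0" "run (v @ u) p \<noteq> p"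
      using moves_near_after_rotation[OF w] by blast
    have "v @ u \<in> lists \<Sigma>" using w(1) uv by simp
    with uv p show ?thesis by blast
  qed
  moreover have "\<exists>x \<in> ray_verts n. run (v @ u) x \<noteq> x"
    if "u @ v \<in> lists \<Sigma>" "p \<in> ray_verts n" "run (u @ v) p \<noteq> p" for u v p
  proof -
    have l: "u \<in> lists \<Sigma>" "v \<in> lists \<Sigma>" using that(1) by auto
    then have V: "run v p \<in> ray_verts n" "run (u @ v) p \<in> ray_verts n"
      using run_closed that by blast+
    have "run v (run (u @ v) p) \<noteq> run v p" using run_inj[OF l(2) V(2) that(2)] that(3) by blast
    then show ?thesis using V(1) by (intro bexI[of _ "run v p"]) simp_all
  qed
  then have "v @ u \<in> {w \<in> lists \<Sigma>. \<exists>x \<in> ray_verts n. run w x \<noteq> x}" if "u @ v \<in> ?L" for u v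
    using that by (simp only: mem_Collect_eq) (metis append_in_lists_conv)
  ultimately have "{w \<in> lists \<Sigma>. \<exists>x \<in> ray_verts n. run w x \<noteq> x} = {v @ u | u v. u @ v \<in> ?L}"
    by (intro equalityI subsetI) (erule CollectE conjE bexE, blast)+
  with context_free_cyclic_closure[OF context_free_low_moves] show ?thesis by simp
qed

end

section \<open>Houghton groups as groups of eventual translations\<close>

definition translates_beyond :: "nat \<Rightarrow> (nat \<times> nat \<Rightarrow> nat \<times> nat) \<Rightarrow> nat \<Rightarrow> (nat \<Rightarrow> int) \<Rightarrow> bool" where
  "translates_beyond n \<Phi> r s \<longleftrightarrow>
     (\<forall>k > r. \<forall>l \<in> {1..n}. int (fst (\<Phi> (k, l))) = int k + s l \<and> snd (\<Phi> (k, l)) = l)"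

lemma translates_beyondD:
  "translates_beyond n \<Phi> r s \<Longrightarrow> r < k \<Longrightarrow> l \<in> {1..n} \<Longrightarrow>
    int (fst (\<Phi> (k, l))) = int k + s l \<and> snd (\<Phi> (k, l)) = l"
  by (simp add: translates_beyond_def)

lemma translates_beyond_mono:
  "translates_beyond n \<Phi> r s \<Longrightarrow> r \<le> r' \<Longrightarrow> translates_beyond n \<Phi> r' s"
  by (simp add: translates_beyond_def)

lemma end_perm_id_iff: "end_perm n \<Phi> id \<longleftrightarrow> (\<exists>r s. translates_beyond n \<Phi> r s)"
proof
  assume "\<exists>r s. translates_beyond n \<Phi> r s"
  then obtain r s where "translates_beyond n \<Phi> (Suc r) s"
    using translates_beyond_mono le_SucI by blast
  then show "end_perm n \<Phi> id"
    unfolding end_perm_def translates_beyond_def by (auto simp: permutes_id intro!: exI[of _ "Suc r"])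
qed (auto simp: end_perm_def translates_beyond_def)

definition houghton_set :: "nat \<Rightarrow> (nat \<times> nat \<Rightarrow> nat \<times> nat) set" where
  "houghton_set n = {\<Phi> \<in> Bij (ray_verts n). \<exists>r s. translates_beyond n \<Phi> r s}"

lemma edge_iff:
  "{u, v} \<in> ray_edges n \<longleftrightarrow>
    snd u = snd v \<and> snd u \<in> {1..n} \<and> (fst u = Suc (fst v) \<or> fst v = Suc (fst u))"
proof
  assume "{u, v} \<in> ray_edges n"
  then obtain i j l where "{u, v} = {(i, l), (j, l)}" "l \<in> {1..n}" "i = j + 1 \<or> j = i + 1"
    unfolding ray_edges_def by blast
  then show "snd u = snd v \<and> snd u \<in> {1..n} \<and> (fst u = Suc (fst v) \<or> fst v = Suc (fst u))"
    by (auto simp: doubleton_eq_iff)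
next
  assume "snd u = snd v \<and> snd u \<in> {1..n} \<and> (fst u = Suc (fst v) \<or> fst v = Suc (fst u))"
  then obtain i j l where "u = (i, l)" "v = (j, l)" "l \<in> {1..n}" "i = j + 1 \<or> j = i + 1"
    by (cases u, cases v) simp
  then show "{u, v} \<in> ray_edges n" unfolding ray_edges_def by blast
qed

lemma finite_neighbours: "finite {v. {u, v} \<in> ray_edges n}"
proof (rule finite_subset)
  show "{v. {u, v} \<in> ray_edges n} \<subseteq> {fst u - 1, Suc (fst u)} \<times> {snd u}"
    by (auto simp: edge_iff)
qed simp

text \<open>A pair of vertices that are both far out is adjacent iff its image is. So a spoiled pair has a member
\<open>u\<close> among the finitely many vertices near the origins, and the other member is adjacent to \<open>u\<close> or has
an image adjacent to \<open>\<Phi> u\<close>.\<close>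

lemma translation_finite_defect:
  assumes \<Phi>: "\<Phi> \<in> Bij (ray_verts n)" and tr: "translates_beyond n \<Phi> r s"
  shows "finite {(u, v) \<in> ray_verts n \<times> ray_verts n.
    ({u, v} \<in> ray_edges n) \<noteq> ({\<Phi> u, \<Phi> v} \<in> ray_edges n)}"
proof -
  let ?V = "ray_verts n" and ?K = "{..r} \<times> {1..n}"
  define N where "N u = {v \<in> ?V. {u, v} \<in> ray_edges n \<or> {\<Phi> u, \<Phi> v} \<in> ray_edges n}" for u
  have inj: "inj_on \<Phi> ?V" using \<Phi> by (simp add: Bij_def bij_betw_def)
  have "finite (N u)" for u
  proof (rule finite_subset)
    show "N u \<subseteq> {v. {u, v} \<in> ray_edges n} \<union> (\<Phi> -` {v. {\<Phi> u, v} \<in> ray_edges n} \<inter> ?V)"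
      by (auto simp: N_def)
    show "finite ({v. {u, v} \<in> ray_edges n} \<union> (\<Phi> -` {v. {\<Phi> u, v} \<in> ray_edges n} \<inter> ?V))"
      using finite_neighbours finite_vimage_IntI[OF finite_neighbours inj] by blast
  qed
  then have fin: "finite (Sigma ?K N)" by (intro finite_SigmaI) simp_all
  have "(u, v) \<in> Sigma ?K N \<union> prod.swap ` Sigma ?K N"
    if u: "u \<in> ?V" and v: "v \<in> ?V"
      and d: "({u, v} \<in> ray_edges n) \<noteq> ({\<Phi> u, \<Phi> v} \<in> ray_edges n)" for u v
  proof -
    have "fst u \<le> r \<or> fst v \<le> r"
    proof (rule ccontr)
      assume "\<not> ?thesis"
      then have far: "r < fst u" "r < fst v" by auto
      have l: "snd u \<in> {1..n}" "snd v \<in> {1..n}" using u v by (auto simp: ray_verts_def)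
      from translates_beyondD[OF tr far(1) l(1)] translates_beyondD[OF tr far(2) l(2)]
      have tu: "int (fst (\<Phi> u)) = int (fst u) + s (snd u)" "snd (\<Phi> u) = snd u"
        and tv: "int (fst (\<Phi> v)) = int (fst v) + s (snd v)" "snd (\<Phi> v) = snd v"
        by simp_all
      have "{u, v} \<in> ray_edges n \<longleftrightarrow> {\<Phi> u, \<Phi> v} \<in> ray_edges n"
      proof (cases "snd u = snd v")
        case True
        with tu tv have "int (fst (\<Phi> u)) - int (fst (\<Phi> v)) = int (fst u) - int (fst v)" by simp
        then have "fst (\<Phi> u) = Suc (fst (\<Phi> v)) \<longleftrightarrow> fst u = Suc (fst v)"
          "fst (\<Phi> v) = Suc (fst (\<Phi> u)) \<longleftrightarrow> fst v = Suc (fst u)" by linarith+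
        with tu(2) tv(2) show ?thesis by (simp add: edge_iff)
      qed (simp add: edge_iff tu(2) tv(2))
      with d show False by blast
    qed
    moreover have "v \<in> N u" "u \<in> N v" using u v d by (auto simp: N_def insert_commute)
    moreover have "x \<in> ?K" if "x \<in> ?V" "fst x \<le> r" for x
      using that by (cases x) (simp add: ray_verts_def)
    ultimately have "(u, v) \<in> Sigma ?K N \<or> (v, u) \<in> Sigma ?K N" using u v by blast
    then show ?thesis by force
  qed
  then have "{(u, v) \<in> ?V \<times> ?V. ({u, v} \<in> ray_edges n) \<noteq> ({\<Phi> u, \<Phi> v} \<in> ray_edges n)}
      \<subseteq> Sigma ?K N \<union> prod.swap ` Sigma ?K N" by blast
  then show ?thesis by (rule finite_subset) (use fin in simp)
qed

text \<open>By the finiteness of the defect, a bijection that is eventually a translation on each ray is a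
quasi-automorphism.\<close>

lemma houghton_group_eq: "houghton_group n = (BijGroup (ray_verts n))\<lparr>carrier := houghton_set n\<rparr>"
proof -
  let ?V = "ray_verts n"
  have "{\<Phi> \<in> carrier (QAut ?V (ray_edges n)). end_perm n \<Phi> id} = houghton_set n"
    using translation_finite_defect
    by (auto simp: QAut_def houghton_set_def end_perm_id_iff simp del: ex_simps)
  then show ?thesis by (simp add: houghton_group_def QAut_def)
qed

lemma translates_beyond_compose:
  assumes tr: "translates_beyond n \<Phi> r s" and tr': "translates_beyond n \<Psi> r' s'"
  shows "\<exists>R. translates_beyond n (compose (ray_verts n) \<Phi> \<Psi>) R (\<lambda>l. s l + s' l)"
proof -
  \<comment> \<open>large enough that \<open>\<Psi>\<close> translates and that the image still lies beyond \<open>r\<close>\<close>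
  define R where "R = r' + r + (\<Sum>l \<in> {1..n}. nat \<bar>s' l\<bar>)"
  have "translates_beyond n (compose (ray_verts n) \<Phi> \<Psi>) R (\<lambda>l. s l + s' l)"
    unfolding translates_beyond_def
  proof (intro allI impI ballI)
    fix k l assume k: "R < k" and l: "l \<in> {1..n}"
    have "nat \<bar>s' l\<bar> \<le> (\<Sum>l \<in> {1..n}. nat \<bar>s' l\<bar>)" using l by (intro member_le_sum) auto
    then have "r' < k" "int r < int k + s' l" using k by (auto simp: R_def)
    have 1: "int (fst (\<Psi> (k, l))) = int k + s' l \<and> snd (\<Psi> (k, l)) = l"
      using translates_beyondD[OF tr' \<open>r' < k\<close> l] .
    then have "r < fst (\<Psi> (k, l))" using \<open>int r < int k + s' l\<close> by linarith
    with translates_beyondD[OF tr this l] 1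
    have "int (fst (\<Phi> (\<Psi> (k, l)))) = int k + s' l + s l \<and> snd (\<Phi> (\<Psi> (k, l))) = l"
      by (metis prod.collapse)
    then show "int (fst (compose (ray_verts n) \<Phi> \<Psi> (k, l))) = int k + (s l + s' l) \<and>
        snd (compose (ray_verts n) \<Phi> \<Psi> (k, l)) = l"
      using l by (simp add: compose_def ray_verts_def)
  qed
  then show ?thesis by blast
qed

lemma translates_beyond_inverse:
  assumes \<Phi>: "\<Phi> \<in> Bij (ray_verts n)" and tr: "translates_beyond n \<Phi> r s"
  shows "\<exists>R. translates_beyond n (\<lambda>x \<in> ray_verts n. inv_into (ray_verts n) \<Phi> x) R (\<lambda>l. - s l)"
proof -
  let ?V = "ray_verts n"
  \<comment> \<open>large enough that the preimage still lies beyond \<open>r\<close>\<close>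
  define R where "R = r + (\<Sum>l \<in> {1..n}. nat \<bar>s l\<bar>)"
  have "translates_beyond n (\<lambda>x \<in> ?V. inv_into ?V \<Phi> x) R (\<lambda>l. - s l)"
    unfolding translates_beyond_def
  proof (intro allI impI ballI)
    fix k l assume k: "R < k" and l: "l \<in> {1..n}"
    have "nat \<bar>s l\<bar> \<le> (\<Sum>l \<in> {1..n}. nat \<bar>s l\<bar>)" using l by (intro member_le_sum) auto
    then have *: "int r < int k - s l" using k by (auto simp: R_def)
    define j where "j = nat (int k - s l)"
    have j: "int j = int k - s l" "r < j" using * by (auto simp: j_def)
    have jV: "(j, l) \<in> ?V" using l by (simp add: ray_verts_def)
    have "\<Phi> (j, l) = (k, l)" using translates_beyondD[OF tr j(2) l] j(1) by (simp add: prod_eq_iff)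
    moreover have "inj_on \<Phi> ?V" using \<Phi> by (simp add: Bij_def bij_betw_def)
    ultimately have "inv_into ?V \<Phi> (k, l) = (j, l)" using jV by (metis inv_into_f_f)
    then show "int (fst ((\<lambda>x \<in> ?V. inv_into ?V \<Phi> x) (k, l))) = int k + - s l \<and>
        snd ((\<lambda>x \<in> ?V. inv_into ?V \<Phi> x) (k, l)) = l"
      using l j(1) by (simp add: ray_verts_def)
  qed
  then show ?thesis by blast
qed

lemma subgroup_houghton_set: "subgroup (houghton_set n) (BijGroup (ray_verts n))"
proof
  let ?V = "ray_verts n"
  show "houghton_set n \<subseteq> carrier (BijGroup ?V)" by (auto simp: houghton_set_def BijGroup_def)
  have "translates_beyond n (\<lambda>x \<in> ?V. x) 0 (\<lambda>_. 0)"
    by (auto simp: translates_beyond_def ray_verts_def)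
  then show "\<one>\<^bsub>BijGroup ?V\<^esub> \<in> houghton_set n"
    using id_Bij by (auto simp: houghton_set_def BijGroup_def)
  fix \<Phi> assume "\<Phi> \<in> houghton_set n"
  then obtain r s where \<Phi>: "\<Phi> \<in> Bij ?V" and tr: "translates_beyond n \<Phi> r s"
    by (auto simp: houghton_set_def)
  show "\<Phi> \<otimes>\<^bsub>BijGroup ?V\<^esub> \<Psi> \<in> houghton_set n" if "\<Psi> \<in> houghton_set n" for \<Psi>
    using that \<Phi> translates_beyond_compose[OF tr] compose_Bij[OF \<Phi>]
    by (fastforce simp: BijGroup_def houghton_set_def)
  show "inv\<^bsub>BijGroup ?V\<^esub> \<Phi> \<in> houghton_set n"
    using inv_BijGroup[OF \<Phi>] restrict_inv_into_Bij[OF \<Phi>] translates_beyond_inverse[OF \<Phi> tr]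
    by (auto simp: houghton_set_def)
qed

lemma carrier_houghton [simp]: "carrier (houghton_group n) = houghton_set n"
  by (simp add: houghton_group_eq)

lemma group_houghton: "group (houghton_group n)"
  unfolding houghton_group_eq
  by (rule subgroup.subgroup_is_group[OF subgroup_houghton_set group_BijGroup])

lemma houghton_Bij: "\<Phi> \<in> houghton_set n \<Longrightarrow> \<Phi> \<in> Bij (ray_verts n)"
  by (simp add: houghton_set_def)

lemma houghton_bij_betw: "\<Phi> \<in> houghton_set n \<Longrightarrow> bij_betw \<Phi> (ray_verts n) (ray_verts n)"
  by (simp add: houghton_set_def Bij_def)

lemma houghton_one: "\<one>\<^bsub>houghton_group n\<^esub> = (\<lambda>x \<in> ray_verts n. x)"
  by (simp add: houghton_group_eq BijGroup_def)

lemma houghton_mult: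
  "\<Phi> \<in> houghton_set n \<Longrightarrow> \<Psi> \<in> houghton_set n \<Longrightarrow>
    \<Phi> \<otimes>\<^bsub>houghton_group n\<^esub> \<Psi> = compose (ray_verts n) \<Phi> \<Psi>"
  by (simp add: houghton_group_eq BijGroup_def houghton_Bij)

lemma houghton_inv:
  assumes "\<Phi> \<in> houghton_set n"
  shows "inv\<^bsub>houghton_group n\<^esub> \<Phi> = (\<lambda>x \<in> ray_verts n. inv_into (ray_verts n) \<Phi> x)"
  using group.m_inv_consistent[OF group_BijGroup subgroup_houghton_set assms]
    inv_BijGroup[OF houghton_Bij[OF assms]]
  by (simp add: houghton_group_eq)

lemma houghton_eqI:
  assumes "\<Phi> \<in> houghton_set n" "\<Psi> \<in> houghton_set n" "\<And>v. v \<in> ray_verts n \<Longrightarrow> \<Phi> v = \<Psi> v"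
  shows "\<Phi> = \<Psi>"
  using assms extensionalityI[OF Bij_imp_extensional Bij_imp_extensional] houghton_Bij by metis

section \<open>The co-word problem\<close>

definition tame :: "nat \<Rightarrow> nat \<Rightarrow> (nat \<times> nat \<Rightarrow> nat \<times> nat) \<Rightarrow> (nat \<Rightarrow> int) \<Rightarrow> bool" where
  "tame n M \<Phi> s \<longleftrightarrow>
    (\<forall>l \<in> {1..n}. \<bar>s l\<bar> \<le> int M) \<and>
    (\<forall>l \<in> {1..n}. \<forall>k \<ge> M. int (fst (\<Phi> (k, l))) = int k + s l \<and> snd (\<Phi> (k, l)) = l) \<and>
    (\<forall>l \<in> {1..n}. \<forall>k < M. fst (\<Phi> (k, l)) < 2 * M)"

text \<open>Stated for all large \<open>M\<close> so that one \<open>M\<close> can serve all letters.\<close>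

lemma eventually_tame:
  assumes "\<Phi> \<in> houghton_set n"
  shows "\<forall>\<^sub>F M in sequentially. \<exists>s. tame n M \<Phi> s"
proof -
  obtain r s where tr: "translates_beyond n \<Phi> r s" using assms by (auto simp: houghton_set_def)
  define S where "S = (\<Sum>l \<in> {1..n}. nat \<bar>s l\<bar>)"
  \<comment> \<open>The sum merely serves as an upper bound for finitely many values.\<close>
  define B where "B = (\<Sum>v \<in> {..r} \<times> {1..n}. fst (\<Phi> v))"
  have S: "\<bar>s l\<bar> \<le> int S" if "l \<in> {1..n}" for l
  proof -
    have "nat \<bar>s l\<bar> \<le> S" unfolding S_def using that by (intro member_le_sum) auto
    then show ?thesis by linarith
  qed
  have B: "fst (\<Phi> (k, l)) \<le> B" if "l \<in> {1..n}" "k \<le> r" for k l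
    unfolding B_def using that by (intro member_le_sum[where f = "\<lambda>v. fst (\<Phi> v)"]) auto
  show ?thesis
    unfolding eventually_sequentially tame_def
  proof (intro exI[of _ "Suc (r + S + B)"] allI impI exI[of _ s] conjI ballI)
    fix M l k :: nat assume M: "Suc (r + S + B) \<le> M" and l: "l \<in> {1..n}"
    show "\<bar>s l\<bar> \<le> int M" using S[OF l] M by linarith
    show "int (fst (\<Phi> (k, l))) = int k + s l" "snd (\<Phi> (k, l)) = l" if "M \<le> k"
      using translates_beyondD[OF tr _ l, of k] that M by auto
    show "fst (\<Phi> (k, l)) < 2 * M" if "k < M"
      using translates_beyondD[OF tr _ l, of k] S[OF l] B[OF l, of k] that M by (cases "k \<le> r") auto
  qed
qed

lemma letter_val_closed:
  assumes "X \<subseteq> houghton_set n" "c \<in> letters X"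
  shows "letter_val (houghton_group n) c \<in> houghton_set n"
proof -
  interpret group "houghton_group n" by (rule group_houghton)
  from assms show ?thesis using inv_closed by (auto simp: letters_def)
qed

lemma word_val_apply:
  assumes "X \<subseteq> houghton_set n" "w \<in> lists (letters X)"
  shows "word_val (houghton_group n) w \<in> houghton_set n \<and>
    (\<forall>v \<in> ray_verts n. word_val (houghton_group n) w v = foldr (letter_val (houghton_group n)) w v)"
  using assms(2)
proof (induction w rule: list.induct)
  case Nil
  interpret group "houghton_group n" by (rule group_houghton)
  have "word_val (houghton_group n) [] \<in> houghton_set n" using one_closed by simp
  then show ?case by (rule conjI) (simp add: houghton_one)
next
  case (Cons c w)
  interpret group "houghton_group n" by (rule group_houghton)
  have c: "letter_val (houghton_group n) c \<in> houghton_set n"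
    using Cons.prems letter_val_closed[OF assms(1)] by auto
  have w: "word_val (houghton_group n) w \<in> houghton_set n"
    "\<forall>v \<in> ray_verts n. word_val (houghton_group n) w v = foldr (letter_val (houghton_group n)) w v"
    using Cons by auto
  have "word_val (houghton_group n) (c # w) \<in> houghton_set n"
    using m_closed[of "letter_val (houghton_group n) c"] c w(1) by simp
  then show ?case by (rule conjI) (simp add: houghton_mult c w compose_def)
qed

text \<open>The letters are finitely many, so one bound \<open>M\<close> makes all of them tame, and their action on the
vertices is a \<open>ray_action\<close>. As elements of the group are determined by their values on vertices, a
word is nontrivial iff it moves a vertex.\<close>

lemma context_free_coword:
  assumes X: "finite X" "X \<subseteq> houghton_set n"
  shows "context_free (letters X) (coword_problem (houghton_group n) X)"
proof -
  let ?H = "houghton_group n"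
  have fin: "finite (letters X)" using X(1) by (simp add: letters_def)
  have "\<forall>\<^sub>F M in sequentially. 0 < M \<and>
      (\<forall>c \<in> letters X. \<exists>s. tame n M (letter_val ?H c) s)"
    using eventually_tame[OF letter_val_closed[OF X(2)]] fin
    by (intro eventually_conj eventually_gt_at_top eventually_ball_finite) blast+
  then obtain M where "0 < M" and "\<forall>c \<in> letters X. \<exists>s. tame n M (letter_val ?H c) s"
    by (auto simp: eventually_sequentially)
  then obtain s where s: "\<forall>c \<in> letters X. tame n M (letter_val ?H c) (s c)"
    by (elim bchoice[THEN exE])
  interpret ray_action n M "letters X" "letter_val ?H" s
  proof
    show "bij_betw (letter_val ?H c) (ray_verts n) (ray_verts n)" if "c \<in> letters X" for c
      using houghton_bij_betw letter_val_closed[OF X(2) that] by blast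
  qed (use \<open>0 < M\<close> fin s[unfolded tame_def] in blast)+
  have "word_val ?H w \<noteq> \<one>\<^bsub>?H\<^esub> \<longleftrightarrow> (\<exists>x \<in> ray_verts n. run w x \<noteq> x)" if "w \<in> lists (letters X)" for w
  proof -
    note w = word_val_apply[OF X(2) that]
    interpret G: group ?H by (rule group_houghton)
    have "word_val ?H w = \<one>\<^bsub>?H\<^esub> \<longleftrightarrow> (\<forall>x \<in> ray_verts n. word_val ?H w x = x)"
      using houghton_eqI[of "word_val ?H w" n "\<one>\<^bsub>?H\<^esub>"] w G.one_closed
      by (auto simp: houghton_one)
    then show ?thesis using w by (auto simp: run_def)
  qed
  then have "coword_problem ?H X = {w \<in> lists (letters X). \<exists>x \<in> ray_verts n. run w x \<noteq> x}"
    unfolding coword_problem_def word_problem_def by blast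
  then show ?thesis using context_free_moving_words by simp
qed

section \<open>Finite generation\<close>

text \<open>The rays \<open>1\<close> and \<open>l\<close>, joined at their origins, form a line. This is its translation by one step
towards the end of the ray \<open>l\<close>.\<close>

definition slide :: "nat \<Rightarrow> nat \<Rightarrow> nat \<times> nat \<Rightarrow> nat \<times> nat" where
  "slide n l = (\<lambda>(k, m) \<in> ray_verts n.
     if m = 1 then (if k = 0 then (0, l) else (k - 1, 1)) else if m = l then (Suc k, l) else (k, m))"

lemma slide_apply:
  assumes "2 \<le> l" "l \<le> n"
  shows "slide n l (0, 1) = (0, l)" "slide n l (Suc k, 1) = (k, 1)" "slide n l (k, l) = (Suc k, l)"
  using assms by (auto simp: slide_def ray_verts_def)

definition slide_shift :: "nat \<Rightarrow> nat \<Rightarrow> int" where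
  "slide_shift l m = (if m = 1 then -1 else if m = l then 1 else 0)"

lemma slide_translates:
  assumes "2 \<le> l" "l \<le> n"
  shows "translates_beyond n (slide n l) 0 (slide_shift l)"
  using assms by (auto simp: translates_beyond_def slide_def ray_verts_def slide_shift_def)

lemma slide_in_houghton:
  assumes "2 \<le> l" "l \<le> n"
  shows "slide n l \<in> houghton_set n"
proof -
  define unslide where "unslide = (\<lambda>(k :: nat, m).
    if m = l then (if k = 0 then (0, 1) else (k - 1, l)) else if m = 1 then (Suc k, 1) else (k, m))"
  have "bij_betw (slide n l) (ray_verts n) (ray_verts n)"
    by (rule bij_betw_byWitness[where f' = unslide])
      (use assms in \<open>auto simp: unslide_def slide_def ray_verts_def split: if_splits\<close>)
  moreover have "slide n l \<in> extensional (ray_verts n)" by (simp add: slide_def)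
  ultimately show ?thesis
    using slide_translates[OF assms] by (auto simp: houghton_set_def Bij_def)
qed

definition swap :: "nat \<Rightarrow> nat \<times> nat \<Rightarrow> nat \<times> nat \<Rightarrow> nat \<times> nat \<Rightarrow> nat \<times> nat" where
  "swap n p q = restrict (transpose p q) (ray_verts n)"

lemma swap_commute: "swap n p q = swap n q p"
  by (simp add: swap_def transpose_commute)

lemma swap_in_houghton:
  assumes "p \<in> ray_verts n" "q \<in> ray_verts n"
  shows "swap n p q \<in> houghton_set n"
proof -
  have "bij_betw (transpose p q) (ray_verts n) (ray_verts n)"
    using assms by (intro bij_betw_byWitness[where f' = "transpose p q"]) (auto simp: transpose_def)
  then have "swap n p q \<in> Bij (ray_verts n)" by (simp add: swap_def Bij_def)
  moreover have "translates_beyond n (swap n p q) (max (fst p) (fst q)) (\<lambda>_. 0)"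
    by (auto simp: translates_beyond_def swap_def ray_verts_def transpose_def)
  ultimately show ?thesis by (auto simp: houghton_set_def)
qed

text \<open>Conjugating a transposition by \<open>g\<close> gives the transposition of the images.\<close>

lemma swap_conjugate:
  assumes K: "subgroup K (houghton_group n)" and g: "g \<in> K"
    and p: "p \<in> ray_verts n" and q: "q \<in> ray_verts n"
  shows "swap n p q \<in> K \<longleftrightarrow> swap n (g p) (g q) \<in> K"
proof -
  let ?H = "houghton_group n" and ?V = "ray_verts n"
  interpret G: group ?H by (rule group_houghton)
  interpret K: subgroup K ?H by (rule K)
  have gH: "g \<in> houghton_set n" using K.subset g by auto
  have bij: "bij_betw g ?V ?V" using houghton_bij_betw[OF gH] .
  then have gV: "g v \<in> ?V" if "v \<in> ?V" for v using that by (rule bij_betw_apply)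
  have inj: "g v = g u \<longleftrightarrow> v = u" if "v \<in> ?V" "u \<in> ?V" for u v
    using bij that by (auto simp: bij_betw_def inj_on_def)
  note sw = swap_in_houghton[OF p q] swap_in_houghton[OF gV[OF p] gV[OF q]]
  have eq: "g \<otimes>\<^bsub>?H\<^esub> swap n p q = swap n (g p) (g q) \<otimes>\<^bsub>?H\<^esub> g"
  proof (rule houghton_eqI)
    show "g \<otimes>\<^bsub>?H\<^esub> swap n p q \<in> houghton_set n" "swap n (g p) (g q) \<otimes>\<^bsub>?H\<^esub> g \<in> houghton_set n"
      using G.m_closed gH sw by simp_all
    fix v assume v: "v \<in> ?V"
    have "g (transpose p q v) = transpose (g p) (g q) (g v)"
      using inj[OF v p] inj[OF v q] by (auto simp: transpose_def)
    then show "(g \<otimes>\<^bsub>?H\<^esub> swap n p q) v = (swap n (g p) (g q) \<otimes>\<^bsub>?H\<^esub> g) v"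
      using v gV[OF v] sw gH by (simp add: houghton_mult compose_def swap_def)
  qed
  show ?thesis
  proof
    assume "swap n p q \<in> K"
    moreover have "swap n (g p) (g q) = g \<otimes>\<^bsub>?H\<^esub> swap n p q \<otimes>\<^bsub>?H\<^esub> inv\<^bsub>?H\<^esub> g"
      using G.inv_solve_right[of "swap n (g p) (g q)" "g \<otimes>\<^bsub>?H\<^esub> swap n p q" g] eq gH sw G.m_closed
      by simp
    ultimately show "swap n (g p) (g q) \<in> K" using g by simp
  next
    assume "swap n (g p) (g q) \<in> K"
    moreover have "swap n p q = inv\<^bsub>?H\<^esub> g \<otimes>\<^bsub>?H\<^esub> (swap n (g p) (g q) \<otimes>\<^bsub>?H\<^esub> g)"
      using G.inv_solve_left[of "swap n p q" g "swap n (g p) (g q) \<otimes>\<^bsub>?H\<^esub> g"] eq gH sw G.m_closed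
      by simp
    ultimately show "swap n p q \<in> K" using g by simp
  qed
qed

lemma swap_self: "swap n p p = \<one>\<^bsub>houghton_group n\<^esub>"
  by (simp add: swap_def houghton_one id_def)

lemma swap_trans:
  assumes K: "subgroup K (houghton_group n)"
    and V: "p \<in> ray_verts n" "q \<in> ray_verts n" "r \<in> ray_verts n"
    and s: "swap n p q \<in> K" "swap n q r \<in> K"
  shows "swap n p r \<in> K"
proof (cases "p = q \<or> p = r")
  case True
  then show ?thesis using s subgroup.one_closed[OF K] by (auto simp: swap_self)
next
  case False
  then have "swap n q r p = p" "swap n q r q = r"
    using V by (auto simp: swap_def transpose_def)
  with swap_conjugate[OF K s(2) V(1,2)] s(1) show ?thesis by simp
qed

definition houghton_gens :: "nat \<Rightarrow> (nat \<times> nat \<Rightarrow> nat \<times> nat) set" where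
  "houghton_gens n = insert (swap n (0, 1) (1, 1)) (slide n ` {2..n})"

lemma houghton_gens_subset: "2 \<le> n \<Longrightarrow> houghton_gens n \<subseteq> houghton_set n"
  using slide_in_houghton swap_in_houghton by (auto simp: houghton_gens_def ray_verts_def)

text \<open>Slides carry the given transposition to those of all neighbours on the lines formed by the ray \<open>1\<close> and
another ray. These lines connect all vertices to the origin of the ray \<open>1\<close>, and
transpositions in a subgroup can be composed along paths by \<open>swap_trans\<close>.\<close>

lemma swap_generated:
  assumes n: "2 \<le> n" and K: "subgroup K (houghton_group n)" and gens: "houghton_gens n \<subseteq> K"
    and p: "p \<in> ray_verts n" and q: "q \<in> ray_verts n"
  shows "swap n p q \<in> K"
proof -
  have V: "(k, l) \<in> ray_verts n" if "1 \<le> l" "l \<le> n" for k l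
    using that by (simp add: ray_verts_def)
  have slide: "slide n l \<in> K" if "2 \<le> l" "l \<le> n" for l
    using gens that by (auto simp: houghton_gens_def)
  have ray1: "swap n (k, 1) (Suc k, 1) \<in> K" for k
  proof (induction k)
    case 0
    then show ?case using gens by (simp add: houghton_gens_def)
  next
    case (Suc k)
    then show ?case
      using swap_conjugate[OF K slide[OF order_refl n], of "(Suc k, 1)" "(Suc (Suc k), 1)"] V n
        slide_apply(2)[OF order_refl n]
      by simp
  qed
  have origins: "swap n (0, 1) (0, l) \<in> K" if l: "2 \<le> l" "l \<le> n" for l
    using swap_conjugate[OF K slide[OF l], of "(0, 1)" "(1, 1)"] ray1[of 0] V n
      slide_apply(1,2)[OF l] swap_commute[of n "(0, 1)" "(0, l)"]
    by simp
  have rays: "swap n (k, l) (Suc k, l) \<in> K" if l: "2 \<le> l" "l \<le> n" for k l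
  proof (induction k)
    case 0
    show ?case
      using swap_conjugate[OF K slide[OF l], of "(0, 1)" "(0, l)"] origins[OF l] V n l
        slide_apply(1,3)[OF l]
      by simp
  next
    case (Suc k)
    then show ?case
      using swap_conjugate[OF K slide[OF l], of "(k, l)" "(Suc k, l)"] V l slide_apply(3)[OF l]
      by simp
  qed
  have base: "swap n (0, 1) v \<in> K" if v: "v \<in> ray_verts n" for v
  proof -
    obtain k l where kl: "v = (k, l)" "1 \<le> l" "l \<le> n" using v by (auto simp: ray_verts_def)
    have step: "swap n (i, l) (Suc i, l) \<in> K" for i
      using ray1 rays kl by (cases "l = 1") auto
    have "swap n (0, 1) (k, l) \<in> K"
    proof (induction k)
      case 0
      then show ?case using origins kl subgroup.one_closed[OF K]
        by (cases "l = 1") (auto simp: swap_self)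
    next
      case (Suc k)
      then show ?case using swap_trans[OF K _ _ _ Suc step] V n kl by simp
    qed
    then show ?thesis using kl by simp
  qed
  have "swap n p (0, 1) \<in> K" using base[OF p] by (simp add: swap_commute)
  then show ?thesis using swap_trans[OF K p _ q _ base[OF q]] V n by simp
qed

lemma finitary_generated:
  assumes n: "2 \<le> n" and K: "subgroup K (houghton_group n)" and gens: "houghton_gens n \<subseteq> K"
    and \<Phi>: "\<Phi> \<in> houghton_set n" and tr: "translates_beyond n \<Phi> r (\<lambda>_. 0)"
  shows "\<Phi> \<in> K"
proof -
  let ?H = "houghton_group n" and ?V = "ray_verts n" and ?S = "{..r} \<times> {1..n}"
  interpret K: subgroup K ?H by (rule K)
  have SV: "?S \<subseteq> ?V" by (auto simp: ray_verts_def)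
  define f where "f x = (if x \<in> ?V then \<Phi> x else x)" for x
  have "bij_betw f ?V ?V"
    using houghton_bij_betw[OF \<Phi>] by (rule bij_betw_cong[THEN iffD1, rotated]) (simp add: f_def)
  then have "f permutes ?V" by (rule bij_imp_permutes) (simp add: f_def)
  then have perm: "f permutes ?S"
  proof (rule permutes_superset)
    fix x assume x: "x \<in> ?V - ?S"
    obtain k l where kl: "x = (k, l)" by (cases x)
    with x have "l \<in> {1..n}" "r < k" by (auto simp: ray_verts_def)
    then have "\<Phi> (k, l) = (k, l)" using translates_beyondD[OF tr, of k l] by (simp add: prod_eq_iff)
    then show "f x = x" by (simp add: f_def kl)
  qed
  have "restrict f ?V \<in> K"
    using perm finite_cartesian_product[OF finite_atMost finite_atLeastAtMost]
  proof (induction rule: permutes_induct)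
    case id
    have "restrict id ?V = \<one>\<^bsub>?H\<^esub>" by (simp add: houghton_one id_def)
    then show ?case by (simp only: K.one_closed)
  next
    case (swap a b p)
    have V: "a \<in> ?V" "b \<in> ?V" using swap SV by auto
    have p: "restrict p ?V \<in> houghton_set n" 
      using K.subset swap.IH unfolding carrier_houghton by (rule subsetD)
    have "p x \<in> ?V" if "x \<in> ?V" for x
      using permutes_in_image[OF permutes_subset[OF swap.hyps(4) SV]] that by simp
    then have "restrict (transpose a b \<circ> p) ?V = swap n a b \<otimes>\<^bsub>?H\<^esub> restrict p ?V"
      using p swap_in_houghton[OF V] by (auto simp: houghton_mult compose_def swap_def fun_eq_iff)
    then show ?case using swap.IH swap_generated[OF n K gens V] by (simp only: K.m_closed)
  qed
  moreover have "restrict f ?V = \<Phi>"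
    using extensional_restrict[OF Bij_imp_extensional[OF houghton_Bij[OF \<Phi>]]]
    by (simp add: f_def cong: restrict_cong)
  ultimately show ?thesis by simp
qed

text \<open>The translation lengths of an element of the group add up to \<open>0\<close>; this is the case in which all of
them but the first vanish. Far out the images are known, so the complement of a finite set \<open>A\<close> goes onto the
complement of an explicit finite set \<open>B\<close>. Hence \<open>A\<close> goes onto \<open>B\<close>, the two have equally many
elements, and the difference of their sizes is the first translation length.\<close>

lemma first_shift_zero:
  assumes n: "1 \<le> n" and \<Phi>: "\<Phi> \<in> houghton_set n" and tr: "translates_beyond n \<Phi> r s"
    and zero: "\<And>l. l \<in> {2..n} \<Longrightarrow> s l = 0"
  shows "s 1 = 0"
proof -
  let ?V = "ray_verts n"
  \<comment> \<open>The margin makes \<open>R + s 1\<close> a natural number, so that \<open>B\<close> can be written down.\<close>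
  define R where "R = r + nat \<bar>s 1\<bar>"
  define R' where "R' = nat (int R + s 1)"
  have R': "int R' = int R + s 1" "r \<le> R" by (auto simp: R_def R'_def)
  define A where "A = {..R} \<times> {1..n}"
  define B where "B = {..R} \<times> {2..n} \<union> {..R'} \<times> {1}"
  have sub: "A \<subseteq> ?V" "B \<subseteq> ?V" using n by (auto simp: A_def B_def ray_verts_def)
  have far: "int (fst (\<Phi> (k, l))) = int k + s l \<and> snd (\<Phi> (k, l)) = l" if "R < k" "l \<in> {1..n}" for k l
    using translates_beyondD[OF tr _ that(2)] that(1) R'(2) by simp
  have image: "\<Phi> ` (?V - A) = ?V - B"
  proof (intro equalityI subsetI)
    fix y assume "y \<in> \<Phi> ` (?V - A)"
    then obtain v where v: "y = \<Phi> v" "v \<in> ?V" "v \<notin> A" by auto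
    obtain k l where "v = (k, l)" by (cases v)
    with v have y: "y = \<Phi> (k, l)" "l \<in> {1..n}" "R < k" by (auto simp: A_def ray_verts_def)
    obtain a where a: "y = (a, l)" "int a = int k + s l"
      using far[OF y(3,2)] unfolding y(1)[symmetric] by (metis prod.collapse)
    with y(2,3) zero[of l] R' show "y \<in> ?V - B"
      by (cases "l = 1") (auto simp: B_def ray_verts_def)
  next
    fix y assume y: "y \<in> ?V - B"
    then obtain k l where kl: "y = (k, l)" "l \<in> {1..n}" by (auto simp: ray_verts_def)
    define j where "j = nat (int k - s l)"
    have j: "R < j" "int j = int k - s l"
      using y kl zero[of l] R' by (cases "l = 1"; auto simp: B_def j_def)+
    then have "y = \<Phi> (j, l)" using far[OF j(1) kl(2)] kl by (simp add: prod_eq_iff)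
    moreover have "(j, l) \<in> ?V - A" using j(1) kl(2) by (simp add: A_def ray_verts_def)
    ultimately show "y \<in> \<Phi> ` (?V - A)" by blast
  qed
  have bij: "inj_on \<Phi> ?V" "\<Phi> ` ?V = ?V"
    using houghton_bij_betw[OF \<Phi>] by (auto simp: bij_betw_def)
  have "\<Phi> ` (?V - A) = ?V - \<Phi> ` A"
    using inj_on_image_set_diff[OF bij(1), of ?V A] sub(1) bij(2) by simp
  with image have "?V - \<Phi> ` A = ?V - B" by simp
  moreover have "\<Phi> ` A \<subseteq> ?V" using image_mono[OF sub(1), of \<Phi>] bij(2) by simp
  ultimately have "\<Phi> ` A = B" using sub(2) by (metis double_diff order_refl)
  then have "card A = card B" using card_image[OF inj_on_subset[OF bij(1) sub(1)]] by simp
  moreover have "card A = Suc R * n" by (simp add: A_def card_cartesian_product)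
  moreover have "card B = Suc R * (n - 1) + Suc R'"
    unfolding B_def by (subst card_Un_disjoint) (auto simp: card_cartesian_product)
  moreover have "Suc R * n = Suc R * (n - 1) + Suc R"
    using n by (cases n) auto
  ultimately show ?thesis using R' by simp
qed

text \<open>Multiplying by a slide or its inverse brings one of the lengths on the rays \<open>2, \<dots>, n\<close> nearer to
\<open>0\<close>. When all of these vanish, so does the first, and the element is finitary.\<close>

lemma houghton_generated:
  assumes n: "2 \<le> n" and K: "subgroup K (houghton_group n)" and gens: "houghton_gens n \<subseteq> K"
    and "\<Phi> \<in> houghton_set n" and "translates_beyond n \<Phi> r s"
  shows "\<Phi> \<in> K"
  using assms(4,5)
proof (induction "\<Sum>l \<in> {2..n}. nat \<bar>s l\<bar>" arbitrary: \<Phi> r s rule: less_induct)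
  case less
  let ?H = "houghton_group n"
  interpret G: group ?H by (rule group_houghton)
  interpret K: subgroup K ?H by (rule K)
  note \<Phi> = less.prems(1) and tr = less.prems(2)
  show ?case
  proof (cases "\<forall>l \<in> {2..n}. s l = 0")
    case True
    then have "s 1 = 0" using first_shift_zero[OF _ \<Phi> tr] n by simp
    then have "s l = 0" if "l \<in> {1..n}" for l
      using True that by (cases "l = 1") auto
    then have "translates_beyond n \<Phi> r (\<lambda>_. 0)" using tr by (simp add: translates_beyond_def)
    then show ?thesis using finitary_generated[OF n K gens \<Phi>] by blast
  next
    case False
    then obtain l where l: "2 \<le> l" "l \<le> n" "s l \<noteq> 0" by auto
    note sl = slide_in_houghton[OF l(1,2)]
    have slK: "slide n l \<in> K" using gens l by (auto simp: houghton_gens_def)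
    obtain h r' t where h: "h \<in> K" "translates_beyond n h r' t"
      and t: "t l = - sgn (s l)" "\<And>m. m \<noteq> 1 \<Longrightarrow> m \<noteq> l \<Longrightarrow> t m = 0"
    proof (cases "s l < 0")
      case True
      then show thesis using that[OF slK slide_translates[OF l(1,2)]] l
        by (auto simp: slide_shift_def)
    next
      case False
      obtain R where "translates_beyond n (inv\<^bsub>?H\<^esub> slide n l) R (\<lambda>m. - slide_shift l m)"
        using translates_beyond_inverse[OF houghton_Bij[OF sl] slide_translates[OF l(1,2)]]
        unfolding houghton_inv[OF sl] by blast
      then show thesis using that[of "inv\<^bsub>?H\<^esub> slide n l"] slK l False
        by (auto simp: slide_shift_def)
    qed
    have hH: "h \<in> houghton_set n" using h(1) K.subset by auto
    obtain R where R: "translates_beyond n (h \<otimes>\<^bsub>?H\<^esub> \<Phi>) R (\<lambda>m. t m + s m)"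
      using translates_beyond_compose[OF h(2) tr] houghton_mult[OF hH \<Phi>] by auto
    have "(\<Sum>m \<in> {2..n}. nat \<bar>t m + s m\<bar>) < (\<Sum>m \<in> {2..n}. nat \<bar>s m\<bar>)"
    proof (rule sum_strict_mono_ex1)
      have l': "nat \<bar>t l + s l\<bar> < nat \<bar>s l\<bar>" using t(1) l(3) by (auto simp: sgn_if)
      then show "\<exists>m \<in> {2..n}. nat \<bar>t m + s m\<bar> < nat \<bar>s m\<bar>" using l by auto
      show "\<forall>m \<in> {2..n}. nat \<bar>t m + s m\<bar> \<le> nat \<bar>s m\<bar>"
      proof
        fix m assume "m \<in> {2..n}"
        then show "nat \<bar>t m + s m\<bar> \<le> nat \<bar>s m\<bar>" using l' t(2)[of m] by (cases "m = l") auto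
      qed
    qed simp
    then have "h \<otimes>\<^bsub>?H\<^esub> \<Phi> \<in> K"
      using less.hyps[OF _ _ R] G.m_closed hH \<Phi> by simp
    then have "inv\<^bsub>?H\<^esub> h \<otimes>\<^bsub>?H\<^esub> (h \<otimes>\<^bsub>?H\<^esub> \<Phi>) \<in> K" using h(1) by simp
    moreover have "inv\<^bsub>?H\<^esub> h \<otimes>\<^bsub>?H\<^esub> (h \<otimes>\<^bsub>?H\<^esub> \<Phi>) = \<Phi>"
      using hH \<Phi> by (metis G.inv_closed G.l_inv G.l_one G.m_assoc carrier_houghton)
    ultimately show ?thesis by simp
  qed
qed

lemma houghton_finitely_generated:
  assumes n: "2 \<le> n"
  shows "finite_generating_set (houghton_group n) (houghton_gens n)"
proof -
  interpret group "houghton_group n" by (rule group_houghton)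
  have sub: "houghton_gens n \<subseteq> carrier (houghton_group n)"
    using houghton_gens_subset[OF n] by simp
  have K: "subgroup (generate (houghton_group n) (houghton_gens n)) (houghton_group n)"
    using generate_is_subgroup[OF sub] .
  have "houghton_gens n \<subseteq> generate (houghton_group n) (houghton_gens n)"
    by (auto intro: generate.incl)
  then have "\<Phi> \<in> generate (houghton_group n) (houghton_gens n)" if "\<Phi> \<in> houghton_set n" for \<Phi>
    using houghton_generated[OF n K _ that] that unfolding houghton_set_def by blast
  then have "houghton_set n \<subseteq> generate (houghton_group n) (houghton_gens n)" by blast
  moreover have "generate (houghton_group n) (houghton_gens n) \<subseteq> houghton_set n"
    using subgroup.subset[OF K] by simp
  moreover have "finite (houghton_gens n)" by (simp add: houghton_gens_def)
  ultimately show ?thesis using sub by (auto simp: finite_generating_set_def)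
qed

theorem corollary2:
  fixes n :: nat
  assumes "n \<ge> 2"
  shows "coCF (houghton_group n)"
  unfolding coCF_def
  using group_houghton houghton_finitely_generated[OF assms] context_free_coword
  by (auto simp: finite_generating_set_def)

end
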